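(* Let $\theta\in(0,1/2)$ be irrational, let $\sigma$ denote the map $x\mapsto x+\theta$ on $\mathbb{T}=\mathbb{R}/\mathbb{Z}$, and let $\mu$ be the Lebesgue measure on $\mathbb{T}$. Let $V$ denote the unitary on $L^2(\mathbb{T})$ induced by $\sigma$. Let $n$ be an integer greater than $1$ and let $W=\chi_C\otimes u^*+\chi_D\otimes v^*\in L^\infty(\mathbb{T})\otimes M_n$, where $C$ is the interval $[0,\theta)\subset\mathbb{T}$ and $D=\mathbb{T}\setminus C$. Then the automorphism $\mathrm{Ad}(WV)$ acts on $L^\infty(\mathbb{T})\otimes M_n$ ergodically.
   Context: $(V\xi)(x)=\xi(x-\theta)$, and $V$ also denotes $V\otimes1$ on $L^2(\mathbb{T})\otimes\mathbb{C}^n$. $M_n$ is the algebra of complex $n\times n$ matrices, $\omega=e^{2\pi i/n}$, $u=\mathrm{diag}(1,\omega,\dots,\omega^{n-1})$, and $v\in M_n$ is the cyclic shift permutation unitary with $vuv^*=\omega u$. $\chi_S$ is the characteristic function of $S$, $\mathrm{Ad}(U)(T)=UTU^*$, and an automorphism acts ergodically if its fixed point algebra is $\mathbb{C}1$. *)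

theory Defs
  imports "HOL-Analysis.Analysis" "Jordan_Normal_Form.Schur_Decomposition"
begin

unbundle no vec_syntax
hide_const (open) Finite_Cartesian_Product.vec
hide_type (open) Finite_Cartesian_Product.vec

section \<open>The circle as a topological group with Lebesgue measure\<close>

quotient_type circle = real / "\<lambda>x y. x - y \<in> \<int>"
  morphisms rep_circle to_circle
proof (rule equivpI)
  show "reflp (\<lambda>x y :: real. x - y \<in> \<int>)"
    by (auto simp: reflp_def)
  show "symp (\<lambda>x y :: real. x - y \<in> \<int>)"
    by (intro sympI) (metis Ints_minus minus_diff_eq)
  show "transp (\<lambda>x y :: real. x - y \<in> \<int>)"
  proof (rule transpI)
    fix x y z :: real
    assume "x - y \<in> \<int>" "y - z \<in> \<int>"
    then have "(x - y) + (y - z) \<in> \<int>" by (rule Ints_add)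
    then show "x - z \<in> \<int>" by simp
  qed
qed

instantiation circle :: ab_group_add
begin

lift_definition zero_circle :: circle is 0 .
lift_definition plus_circle :: "circle \<Rightarrow> circle \<Rightarrow> circle" is "(+)"
proof -
  fix a b c d :: real
  assume "a - b \<in> \<int>" "c - d \<in> \<int>"
  then have "(a - b) + (c - d) \<in> \<int>" by (rule Ints_add)
  then show "(a + c) - (b + d) \<in> \<int>" by (simp add: algebra_simps)
qed
lift_definition minus_circle :: "circle \<Rightarrow> circle \<Rightarrow> circle" is "(-)"
proof -
  fix a b c d :: real
  assume "a - b \<in> \<int>" "c - d \<in> \<int>"
  then have "(a - b) - (c - d) \<in> \<int>" by (rule Ints_diff)
  then show "(a - c) - (b - d) \<in> \<int>" by (simp add: algebra_simps)
qed
lift_definition uminus_circle :: "circle \<Rightarrow> circle" is "uminus"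
proof -
  fix a b :: real
  assume "a - b \<in> \<int>"
  then have "- (a - b) \<in> \<int>" by (rule Ints_minus)
  then show "- a - - b \<in> \<int>" by simp
qed

instance
  by standard (transfer; simp)+

end

text \<open>The quotient topology of $\mathbb{R}$.\<close>

instantiation circle :: topological_space
begin

definition open_circle :: "circle set \<Rightarrow> bool"
  where "open_circle U \<longleftrightarrow> open (to_circle -` U)"

instance
proof
  show "open (UNIV :: circle set)" by (simp add: open_circle_def)
  fix S T :: "circle set"
  assume "open S" "open T"
  then show "open (S \<inter> T)" by (simp add: open_circle_def open_Int)
next
  fix K :: "circle set set"
  assume "\<forall>S\<in>K. open S"
  then show "open (\<Union>K)" by (auto simp: open_circle_def vimage_Union)
qed

end

definition circle_measure :: "circle measure"
  where "circle_measure = distr (restrict_space lborel {0..<1}) borel to_circle"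

lemma sets_circle_measure [simp, measurable_cong]: "sets circle_measure = sets borel"
  by (simp add: circle_measure_def)

lemma space_circle_measure [simp]: "space circle_measure = UNIV"
  by (simp add: circle_measure_def)

lemma measurable_to_circle [measurable]: "to_circle \<in> borel_measurable borel"
proof (rule borel_measurable_continuous_onI)
  have "open (to_circle -` U)" if "open U" for U
    using that by (simp add: open_circle_def)
  then show "continuous_on UNIV to_circle"
    by (simp add: continuous_on_open_vimage)
qed

lemma measurable_circle_translate [measurable]:
  fixes a :: circle
  shows "(\<lambda>x. x - a) \<in> borel_measurable borel"
proof (rule borel_measurable_continuous_onI)
  have "open ((\<lambda>x. x - a) -` U)" if "open U" for U :: "circle set"
  proof -
    obtain t where t: "a = to_circle t"
      by (induction a rule: circle.abs_induct) blast
    have "to_circle -` ((\<lambda>x. x - a) -` U) = (\<lambda>x. x - t) -` (to_circle -` U)"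
      by (auto simp: t minus_circle.abs_eq)
    moreover have "open ((\<lambda>x. x - t) -` (to_circle -` U))"
    proof (rule open_vimage)
      show "open (to_circle -` U)" using that by (simp add: open_circle_def)
    qed (intro continuous_intros)
    ultimately show ?thesis by (simp add: open_circle_def)
  qed
  then show "continuous_on UNIV (\<lambda>x. x - a)"
    by (simp add: continuous_on_open_vimage)
qed

lemma to_circle_add_int: "to_circle (x + of_int k) = to_circle x"
  by (simp add: circle.abs_eq_iff)

lemma emeasure_circle_measure:
  assumes "A \<in> sets borel"
  shows "emeasure circle_measure A = emeasure lborel (to_circle -` A \<inter> {0..<1})"
proof -
  have "emeasure circle_measure A =
      emeasure (restrict_space lborel {0..<1::real}) (to_circle -` A \<inter> {0..<1})"
    unfolding circle_measure_def using assms
    by (subst emeasure_distr)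
      (auto simp: space_restrict_space intro!: measurable_restrict_space1)
  also have "\<dots> = emeasure lborel (to_circle -` A \<inter> {0..<1})"
    by (rule emeasure_restrict_space) auto
  finally show ?thesis .
qed

lemma emeasure_lborel_translate:
  fixes t :: real
  assumes "A \<in> sets borel"
  shows "emeasure lborel ((\<lambda>x. x - t) -` A) = emeasure lborel A"
proof -
  have "emeasure lborel A = emeasure (distr lborel borel (\<lambda>x. - t + x)) A"
    by (subst lborel_distr_plus) (rule refl)
  also have "\<dots> = emeasure lborel ((\<lambda>x. - t + x) -` A)"
    using assms by (subst emeasure_distr) auto
  also have "(\<lambda>x. - t + x) -` A = (\<lambda>x. x - t) -` A" by auto
  finally show ?thesis by simp
qed

lemma distr_circle_translate:
  fixes a :: circle
  shows "distr circle_measure borel (\<lambda>x. x - a) = circle_measure"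
proof (rule measure_eqI)
  fix A assume "A \<in> sets (distr circle_measure borel (\<lambda>x. x - a))"
  then have A: "A \<in> sets borel" by simp
  obtain t0 where t0: "a = to_circle t0"
    by (induction a rule: circle.abs_induct) blast
  define t where "t = frac t0"
  have t: "a = to_circle t" "0 \<le> t" "t < 1"
    using to_circle_add_int[of t "\<lfloor>t0\<rfloor>"]
    by (auto simp: t0 t_def frac_def frac_lt_1[unfolded frac_def])
  define P where "P = to_circle -` A"
  have Pm [measurable]: "P \<in> sets borel"
    unfolding P_def using measurable_sets[OF measurable_to_circle A] by simp
  have per: "x + 1 \<in> P \<longleftrightarrow> x \<in> P" for x
    using to_circle_add_int[of x 1] by (simp add: P_def)
  have "emeasure (distr circle_measure borel (\<lambda>x. x - a)) A =
      emeasure circle_measure ((\<lambda>x. x - a) -` A)"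
    using A by (subst emeasure_distr) auto
  also have "\<dots> = emeasure lborel (to_circle -` ((\<lambda>x. x - a) -` A) \<inter> {0..<1})"
    using measurable_sets[OF measurable_circle_translate A]
    by (intro emeasure_circle_measure) simp
  also have "to_circle -` ((\<lambda>x. x - a) -` A) \<inter> {0..<1} =
      (\<lambda>x. x - t) -` (P \<inter> {-t..<1-t})"
    by (auto simp: P_def t(1) minus_circle.abs_eq)
  also have "emeasure lborel \<dots> = emeasure lborel (P \<inter> {-t..<1-t})"
    by (rule emeasure_lborel_translate) auto
  also have "P \<inter> {-t..<1-t} = (P \<inter> {-t..<0}) \<union> (P \<inter> {0..<1-t})"
    using t by auto
  also have "emeasure lborel \<dots> =
      emeasure lborel (P \<inter> {-t..<0}) + emeasure lborel (P \<inter> {0..<1-t})"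
    by (intro plus_emeasure[symmetric]) auto
  also have "P \<inter> {-t..<0} = (\<lambda>x. x - (-1)) -` (P \<inter> {1-t..<1})"
    using per by auto
  also have "emeasure lborel \<dots> = emeasure lborel (P \<inter> {1-t..<1})"
    by (rule emeasure_lborel_translate) auto
  also have "\<dots> + emeasure lborel (P \<inter> {0..<1-t}) =
      emeasure lborel ((P \<inter> {1-t..<1}) \<union> (P \<inter> {0..<1-t}))"
    by (intro plus_emeasure) auto
  also have "(P \<inter> {1-t..<1}) \<union> (P \<inter> {0..<1-t}) = to_circle -` A \<inter> {0..<1}"
    using t by (auto simp: P_def)
  also have "emeasure lborel \<dots> = emeasure circle_measure A"
    using A by (simp add: emeasure_circle_measure)
  finally show "emeasure (distr circle_measure borel (\<lambda>x. x - a)) A =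
    emeasure circle_measure A" .
qed simp

lifting_forget circle.lifting

section \<open>$L^2(\mathbb{T})$\<close>

definition sq_integrable :: "(circle \<Rightarrow> complex) \<Rightarrow> bool"
  where "sq_integrable f \<longleftrightarrow> f \<in> borel_measurable circle_measure \<and>
    integrable circle_measure (\<lambda>x. (norm (f x))\<^sup>2)"

definition l2_rel :: "(circle \<Rightarrow> complex) \<Rightarrow> (circle \<Rightarrow> complex) \<Rightarrow> bool"
  where "l2_rel f g \<longleftrightarrow> sq_integrable f \<and> sq_integrable g \<and> (AE x in circle_measure. f x = g x)"

lemma sq_integrable_measurable [dest]:
  "sq_integrable f \<Longrightarrow> f \<in> borel_measurable circle_measure"
  by (simp add: sq_integrable_def)

lemma sq_integrable_zero: "sq_integrable (\<lambda>_. 0)"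
  by (simp add: sq_integrable_def)

lemma sq_integrable_bounded_mult:
  assumes f: "sq_integrable f" and c: "c \<in> borel_measurable circle_measure"
    and B: "AE x in circle_measure. norm (c x) \<le> B"
  shows "sq_integrable (\<lambda>x. c x * f x)"
  unfolding sq_integrable_def
proof (intro conjI)
  note [measurable] = sq_integrable_measurable[OF f] c
  show "(\<lambda>x. c x * f x) \<in> borel_measurable circle_measure" by measurable
  show "integrable circle_measure (\<lambda>x. (norm (c x * f x))\<^sup>2)"
  proof (rule Bochner_Integration.integrable_bound)
    show "integrable circle_measure (\<lambda>x. B\<^sup>2 * (norm (f x))\<^sup>2)"
      using f by (simp add: sq_integrable_def)
    show "AE x in circle_measure. norm ((norm (c x * f x))\<^sup>2) \<le> norm (B\<^sup>2 * (norm (f x))\<^sup>2)"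
      using B by eventually_elim
        (auto simp: norm_mult power_mult_distrib intro!: mult_right_mono power_mono)
  qed measurable
qed

lemma sq_integrable_add:
  assumes f: "sq_integrable f" and g: "sq_integrable g"
  shows "sq_integrable (\<lambda>x. f x + g x)"
  unfolding sq_integrable_def
proof (intro conjI)
  note [measurable] = sq_integrable_measurable[OF f] sq_integrable_measurable[OF g]
  show "(\<lambda>x. f x + g x) \<in> borel_measurable circle_measure" by measurable
  have bd: "(norm (z + w))\<^sup>2 \<le> 2 * (norm z)\<^sup>2 + 2 * (norm w)\<^sup>2" for z w :: complex
  proof -
    have "(norm (z + w))\<^sup>2 \<le> (norm z + norm w)\<^sup>2"
      by (intro power_mono norm_triangle_ineq) auto
    moreover have "0 \<le> (norm z - norm w)\<^sup>2" by simp
    ultimately show ?thesis by (simp add: power2_sum power2_diff)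
  qed
  show "integrable circle_measure (\<lambda>x. (norm (f x + g x))\<^sup>2)"
  proof (rule Bochner_Integration.integrable_bound)
    show "integrable circle_measure (\<lambda>x. 2 * (norm (f x))\<^sup>2 + 2 * (norm (g x))\<^sup>2)"
      using f g by (simp add: sq_integrable_def)
  qed (use bd in auto)
qed

lemma sq_integrable_scale: "sq_integrable f \<Longrightarrow> sq_integrable (\<lambda>x. c * f x)"
  by (rule sq_integrable_bounded_mult[where B = "norm c"]) auto

lemma sq_integrable_translate:
  assumes f: "sq_integrable f"
  shows "sq_integrable (\<lambda>x. f (x - a))"
  unfolding sq_integrable_def
proof (intro conjI)
  have fm [measurable]: "f \<in> borel_measurable borel"
    using f by (simp add: sq_integrable_def cong: measurable_cong_sets)
  show "(\<lambda>x. f (x - a)) \<in> borel_measurable circle_measure" by measurable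
  have "integrable (distr circle_measure borel (\<lambda>x. x - a)) (\<lambda>x. (norm (f x))\<^sup>2)"
    using f by (simp add: distr_circle_translate sq_integrable_def)
  then show "integrable circle_measure (\<lambda>x. (norm (f (x - a)))\<^sup>2)"
    by (subst (asm) integrable_distr_eq) auto
qed

lemma AE_circle_translate:
  fixes a :: circle
  assumes "AE x in circle_measure. P x"
  shows "AE x in circle_measure. P (x - a)"
proof -
  have "(\<lambda>x. x - a) \<in> measurable circle_measure borel" by measurable
  moreover have "AE x in distr circle_measure borel (\<lambda>x. x - a). P x"
    unfolding distr_circle_translate by (rule assms)
  ultimately show ?thesis by (rule AE_distrD)
qed

quotient_type l2 = "circle \<Rightarrow> complex" / partial: l2_rel
proof (rule part_equivpI)
  show "\<exists>f. l2_rel f f" using sq_integrable_zero by (auto simp: l2_rel_def)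
  show "symp l2_rel" by (auto simp: symp_def l2_rel_def)
  show "transp l2_rel" by (rule transpI) (auto simp: l2_rel_def)
qed

lift_definition l2_scale :: "complex \<Rightarrow> l2 \<Rightarrow> l2" is "\<lambda>c f x. c * f x"
  by (auto simp: l2_rel_def sq_integrable_scale)

instantiation l2 :: ab_group_add
begin

lift_definition zero_l2 :: l2 is "\<lambda>_. 0"
  by (simp add: l2_rel_def sq_integrable_zero)
lift_definition plus_l2 :: "l2 \<Rightarrow> l2 \<Rightarrow> l2" is "\<lambda>f g x. f x + g x"
  by (auto simp: l2_rel_def sq_integrable_add)
lift_definition uminus_l2 :: "l2 \<Rightarrow> l2" is "\<lambda>f x. - f x"
  using sq_integrable_scale[of _ "-1"] by (auto simp: l2_rel_def)
definition minus_l2 :: "l2 \<Rightarrow> l2 \<Rightarrow> l2"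
  where "minus_l2 f g = f + (- g)"

instance
proof
  fix a b c :: l2
  show "a + b + c = a + (b + c)"
    by transfer (simp add: l2_rel_def sq_integrable_add add.assoc)
  show "a + b = b + a"
    by transfer (simp add: l2_rel_def sq_integrable_add add.commute)
  show "0 + a = a"
    by transfer (simp add: l2_rel_def)
  show "- a + a = 0"
    by transfer (simp add: l2_rel_def sq_integrable_zero)
  show "a - b = a + - b" by (simp add: minus_l2_def)
qed

end

lift_definition l2_inner :: "l2 \<Rightarrow> l2 \<Rightarrow> complex"
  is "\<lambda>f g. lebesgue_integral circle_measure (\<lambda>x. f x * cnj (g x))"
proof (rule integral_cong_AE)
  fix f f' g g' :: "circle \<Rightarrow> complex"
  assume "l2_rel f f'" "l2_rel g g'"
  then have [measurable]: "f \<in> borel_measurable circle_measure"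
      "f' \<in> borel_measurable circle_measure" "g \<in> borel_measurable circle_measure"
      "g' \<in> borel_measurable circle_measure"
    and ae: "AE x in circle_measure. f x = f' x" "AE x in circle_measure. g x = g' x"
    by (auto simp: l2_rel_def)
  have [measurable]: "cnj \<in> borel_measurable borel"
    by (intro borel_measurable_continuous_onI continuous_intros)
  show "(\<lambda>x. f x * cnj (g x)) \<in> borel_measurable circle_measure"
    "(\<lambda>x. f' x * cnj (g' x)) \<in> borel_measurable circle_measure"
    by measurable
  show "AE x in circle_measure. f x * cnj (g x) = f' x * cnj (g' x)"
    using ae by eventually_elim simp
qed

lift_definition l2_translate :: "circle \<Rightarrow> l2 \<Rightarrow> l2"
  is "\<lambda>a f x. f (x - a)"
  unfolding l2_rel_def by (intro conjI sq_integrable_translate AE_circle_translate) auto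

section \<open>$L^\infty(\mathbb{T})$ acting by multiplication\<close>

definition ess_bounded :: "(circle \<Rightarrow> complex) \<Rightarrow> bool"
  where "ess_bounded f \<longleftrightarrow> f \<in> borel_measurable circle_measure \<and>
    (\<exists>B. AE x in circle_measure. norm (f x) \<le> B)"

text \<open>The value for functions that are not essentially bounded is a dummy.\<close>

lift_definition mult_op :: "(circle \<Rightarrow> complex) \<Rightarrow> l2 \<Rightarrow> l2"
  is "\<lambda>f g x. if ess_bounded f then f x * g x else 0"
proof -
  fix f g g' :: "circle \<Rightarrow> complex"
  assume gg': "l2_rel g g'"
  show "l2_rel (\<lambda>x. if ess_bounded f then f x * g x else 0)
    (\<lambda>x. if ess_bounded f then f x * g' x else 0)"
  proof (cases "ess_bounded f")
    case True
    then obtain B where "f \<in> borel_measurable circle_measure"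
      "AE x in circle_measure. norm (f x) \<le> B"
      by (auto simp: ess_bounded_def)
    with True gg' show ?thesis
      by (auto simp: l2_rel_def intro: sq_integrable_bounded_mult)
  qed (simp add: l2_rel_def sq_integrable_zero)
qed

section \<open>Operators on $L^2(\mathbb{T}) \otimes \mathbb{C}^n$\<close>

text \<open>
  $L^2(\mathbb{T}) \otimes \mathbb{C}^n$ is the $n$-fold direct sum of $L^2(\mathbb{T})$, with
  $\xi \otimes e_i$ having $\xi$ in position $i$. Operators are extensional functions on it,
  so that equality of operators is equality in HOL.
\<close>

type_synonym oper = "l2 vec \<Rightarrow> l2 vec"

abbreviation l2_tensor :: "nat \<Rightarrow> l2 vec set"
  where "l2_tensor n \<equiv> carrier_vec n"

definition inner_tensor :: "nat \<Rightarrow> l2 vec \<Rightarrow> l2 vec \<Rightarrow> complex"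
  where "inner_tensor n \<xi> \<eta> = (\<Sum>i<n. l2_inner (\<xi> $ i) (\<eta> $ i))"

definition op_one :: "nat \<Rightarrow> oper"
  where "op_one n = (\<lambda>\<xi>\<in>l2_tensor n. \<xi>)"

definition op_add :: "nat \<Rightarrow> oper \<Rightarrow> oper \<Rightarrow> oper"
  where "op_add n S T = (\<lambda>\<xi>\<in>l2_tensor n. S \<xi> + T \<xi>)"

definition op_scale :: "nat \<Rightarrow> complex \<Rightarrow> oper \<Rightarrow> oper"
  where "op_scale n c T = (\<lambda>\<xi>\<in>l2_tensor n. map_vec (l2_scale c) (T \<xi>))"

definition op_mult :: "nat \<Rightarrow> oper \<Rightarrow> oper \<Rightarrow> oper"
  where "op_mult n S T = compose (l2_tensor n) S T"

definition op_adjoint :: "nat \<Rightarrow> oper \<Rightarrow> oper"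
  where "op_adjoint n T = (\<lambda>\<eta>\<in>l2_tensor n. THE \<zeta>. \<zeta> \<in> l2_tensor n \<and>
    (\<forall>\<xi>\<in>l2_tensor n. inner_tensor n (T \<xi>) \<eta> = inner_tensor n \<xi> \<zeta>))"

text \<open>$S \otimes a$ for a linear operator $S$ on $L^2(\mathbb{T})$ and $a \in M_n$.\<close>

definition op_tensor :: "nat \<Rightarrow> (l2 \<Rightarrow> l2) \<Rightarrow> complex mat \<Rightarrow> oper"
  where "op_tensor n S a = (\<lambda>\<xi>\<in>l2_tensor n.
    Matrix.vec n (\<lambda>i. \<Sum>j<n. l2_scale (a $$ (i, j)) (S (\<xi> $ j))))"

text \<open>
  $L^\infty(\mathbb{T}) \otimes M_n$ is the linear span of the elementary tensors; as $M_n$ is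
  finite-dimensional, this span is already weakly closed.
\<close>

inductive_set Linf_tensor_M :: "nat \<Rightarrow> oper set" for n :: nat where
  elementary: "ess_bounded f \<Longrightarrow> a \<in> carrier_mat n n \<Longrightarrow> op_tensor n (mult_op f) a \<in> Linf_tensor_M n"
| add: "S \<in> Linf_tensor_M n \<Longrightarrow> T \<in> Linf_tensor_M n \<Longrightarrow> op_add n S T \<in> Linf_tensor_M n"

definition Ad :: "nat \<Rightarrow> oper \<Rightarrow> oper \<Rightarrow> oper"
  where "Ad n U T = op_mult n (op_mult n U T) (op_adjoint n U)"

definition star_automorphism :: "nat \<Rightarrow> oper set \<Rightarrow> (oper \<Rightarrow> oper) \<Rightarrow> bool"
  where "star_automorphism n A \<alpha> \<longleftrightarrow> bij_betw \<alpha> A A \<and>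
    (\<forall>S\<in>A. \<forall>T\<in>A. \<alpha> (op_add n S T) = op_add n (\<alpha> S) (\<alpha> T)) \<and>
    (\<forall>c. \<forall>T\<in>A. \<alpha> (op_scale n c T) = op_scale n c (\<alpha> T)) \<and>
    (\<forall>S\<in>A. \<forall>T\<in>A. \<alpha> (op_mult n S T) = op_mult n (\<alpha> S) (\<alpha> T)) \<and>
    (\<forall>T\<in>A. \<alpha> (op_adjoint n T) = op_adjoint n (\<alpha> T))"

definition acts_ergodically :: "nat \<Rightarrow> oper set \<Rightarrow> (oper \<Rightarrow> oper) \<Rightarrow> bool"
  where "acts_ergodically n A \<alpha> \<longleftrightarrow> {T \<in> A. \<alpha> T = T} = range (\<lambda>c. op_scale n c (op_one n))"

section \<open>The matrices $u$ and $v$\<close>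

definition root_unity :: "nat \<Rightarrow> complex"
  where "root_unity n = exp (2 * of_real pi * \<i> / of_nat n)"

definition clock_mat :: "nat \<Rightarrow> complex mat"
  where "clock_mat n = mat n n (\<lambda>(i, j). if i = j then root_unity n ^ i else 0)"

text \<open>
  The shift sends $e_j$ to $e_{j-1}$ (indices modulo $n$); this is the direction for which
  $v u v^* = \omega u$.
\<close>

definition shift_mat :: "nat \<Rightarrow> complex mat"
  where "shift_mat n = mat n n (\<lambda>(i, j). if j = Suc i mod n then 1 else 0)"

lemma root_unity_power: "n > 0 \<Longrightarrow> root_unity n ^ n = 1"
  by (simp add: root_unity_def flip: exp_of_nat_mult)

lemma shift_clock_shift:
  assumes n: "n > 0"
  shows "shift_mat n * clock_mat n * mat_adjoint (shift_mat n) = root_unity n \<cdot>\<^sub>m clock_mat n"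
proof -
  define A where "A = mat n n (\<lambda>(i, j). if j = Suc i mod n then root_unity n ^ j else 0)"
  define B where "B = mat n n (\<lambda>(i, j). if i = Suc j mod n then 1 else 0 :: complex)"
  have A: "shift_mat n * clock_mat n = A"
    by (rule eq_matI)
      (auto simp: A_def shift_mat_def clock_mat_def scalar_prod_def if_distrib cong: if_cong)
  have B: "mat_adjoint (shift_mat n) = B"
    by (rule eq_matI) (auto simp: B_def mat_adjoint_def shift_mat_def mat_of_rows_def)
  have inj: "i = j" if "i < n" "j < n" "Suc i mod n = Suc j mod n" for i j
    using that by (auto simp: mod_Suc split: if_splits)
  have pow: "root_unity n ^ (Suc i mod n) = root_unity n * root_unity n ^ i" if "i < n" for i
    using that root_unity_power[OF n] by (auto simp: mod_Suc simp flip: power_Suc)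
  have "A * B = root_unity n \<cdot>\<^sub>m clock_mat n"
    by (rule eq_matI)
      (auto simp: A_def B_def clock_mat_def scalar_prod_def pow n if_distrib
        cong: if_cong dest: inj)
  then show ?thesis by (simp add: A B)
qed

end

theory Submission
  imports Defs
begin

text \<open>
  Elements of $L^\infty(\mathbb{T}) \otimes M_n$ are bounded matrix functions $F$, and $F$ is fixed by
  $\mathrm{Ad}(WV)$ iff $F(x) = w(x) F(x - \theta) w(x)^*$ almost everywhere, where $w$ is $u^*$ on $C$
  and $v^*$ on $D$. Since $u$ and $v$ commute up to $\omega$, the matrices $u^a v^b$ diagonalise
  both $\mathrm{Ad}(u^*)$ and $\mathrm{Ad}(v^*)$, so every component $f$ of $F$ satisfies
  $f(x) = \omega^b f(x - \theta)$ on $C$ and $f(x) = \omega^c f(x - \theta)$ on $D$ for some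
  $0 \le b, c < n$. As $\{x\} - \{x - \theta\} = \theta - \chi_C(x)$, the function
  $e^{2\pi i (b - c)\{x\}/n} f(x)$ is an eigenfunction of the rotation with eigenvalue
  $e^{2\pi i (c + (b - c)\theta)/n}$. By uniqueness of Fourier coefficients it vanishes unless
  $c + (b - c)\theta \in n(\mathbb{Z} + \mathbb{Z}\theta)$, which for irrational $\theta$ forces
  $b = c = 0$; then $f$ is invariant, hence constant.
\<close>


text \<open>The multiplier of a component is a step function with two values, so the component
  itself is in general no eigenfunction of the rotation. It can be turned into one because the jump
  occurs on the very arc [0, \<theta>) on which the fractional part wraps around, so a phase linear
  in the fractional part levels the two values. The price is the extra \<theta> in the eigenvalue.
  Irrationality then separates the coefficients of 1 and \<theta> in c + (b - c) \<theta> = n (l - m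
  \<theta>): n divides c and b - c, hence b, and 0 <= b, c < n leaves only zero.

  Two obstacles shape the rest. Operators act on classes of functions, so \<open>F\<close> is
  determined by \<open>Mop n F\<close> only almost everywhere; as there are finitely many entries,
  one null set serves all components. Uniqueness of Fourier coefficients is wanted for bounded
  functions only, and it is derived from Stone-Weierstrass approximation and a generator of the
  Borel sets, without an orthonormal basis of L^2.\<close>

interpretation circle_measure: finite_measure circle_measure
proof (rule finite_measureI)
  show "emeasure circle_measure (space circle_measure) \<noteq> \<infinity>"
    by (simp add: emeasure_circle_measure)
qed

lemma borel_measurable_cnj [measurable]: "cnj \<in> borel_measurable borel"
  by (intro borel_measurable_continuous_onI continuous_intros)

lemma integrable_circle_mult:
  assumes "sq_integrable f" "sq_integrable g"
  shows "integrable circle_measure (\<lambda>x. f x * cnj (g x))"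
proof (rule Bochner_Integration.integrable_bound)
  show "integrable circle_measure (\<lambda>x. (norm (f x))\<^sup>2 + (norm (g x))\<^sup>2)"
    using assms by (simp add: sq_integrable_def)
  have [measurable]: "f \<in> borel_measurable circle_measure" "g \<in> borel_measurable circle_measure"
    using assms by auto
  show "(\<lambda>x. f x * cnj (g x)) \<in> borel_measurable circle_measure"
    by measurable
  have "a * b \<le> a\<^sup>2 + b\<^sup>2" if "0 \<le> a" "0 \<le> b" for a b :: real
    using sum_squares_bound[of a b] mult_nonneg_nonneg[OF that] by linarith
  then show "AE x in circle_measure. norm (f x * cnj (g x)) \<le> norm ((norm (f x))\<^sup>2 + (norm (g x))\<^sup>2)"
    by (auto simp: norm_mult)
qed

subsection \<open>Multiplication operators and translations on $L^2(\mathbb{T})$\<close>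

lemma ess_bounded_const [simp, intro]: "ess_bounded (\<lambda>_. c)"
  by (auto simp: ess_bounded_def)

lemma ess_bounded_add :
  assumes "ess_bounded f" "ess_bounded g"
  shows "ess_bounded (\<lambda>x. f x + g x)"
proof -
  obtain B B' where B: "AE x in circle_measure. norm (f x) \<le> B" "AE x in circle_measure. norm (g x) \<le> B'"
    using assms by (auto simp: ess_bounded_def)
  from B have "AE x in circle_measure. norm (f x + g x) \<le> B + B'"
    by eventually_elim (metis add_mono norm_triangle_ineq order_trans)
  then show ?thesis using assms by (auto simp: ess_bounded_def)
qed

lemma ess_bounded_mult :
  assumes "ess_bounded f" "ess_bounded g"
  shows "ess_bounded (\<lambda>x. f x * g x)"
proof -
  obtain B B' where B: "AE x in circle_measure. norm (f x) \<le> B" "AE x in circle_measure. norm (g x) \<le> B'"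
    using assms by (auto simp: ess_bounded_def)
  from B have "AE x in circle_measure. norm (f x * g x) \<le> \<bar>B\<bar> * \<bar>B'\<bar>"
    by eventually_elim (auto simp: norm_mult intro!: mult_mono)
  then show ?thesis using assms by (auto simp: ess_bounded_def)
qed

lemma ess_bounded_cnj : "ess_bounded f \<Longrightarrow> ess_bounded (\<lambda>x. cnj (f x))"
  by (auto simp: ess_bounded_def)

lemma ess_bounded_sum :
  "(\<And>i. i \<in> I \<Longrightarrow> ess_bounded (f i)) \<Longrightarrow> ess_bounded (\<lambda>x. \<Sum>i\<in>I. f i x)"
  by (induction I rule: infinite_finite_induct) (auto intro: ess_bounded_add)

lemma ess_bounded_translate:
  assumes "ess_bounded f"
  shows "ess_bounded (\<lambda>x. f (x - a))"
proof -
  have [measurable]: "f \<in> borel_measurable borel"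
    using assms by (simp add: ess_bounded_def cong: measurable_cong_sets)
  obtain B where "AE x in circle_measure. norm (f x) \<le> B"
    using assms by (auto simp: ess_bounded_def)
  then have "AE x in circle_measure. norm (f (x - a)) \<le> B"
    by (rule AE_circle_translate)
  then show ?thesis by (auto simp: ess_bounded_def)
qed

lemma ess_bounded_mult_sq_integrable:
  assumes "ess_bounded f" "sq_integrable g"
  shows "sq_integrable (\<lambda>x. f x * g x)"
proof -
  obtain B where "AE x in circle_measure. norm (f x) \<le> B"
    using assms by (auto simp: ess_bounded_def)
  with assms show ?thesis
    by (intro sq_integrable_bounded_mult[of g f B]) (simp_all add: ess_bounded_def)
qed

lemma mult_op_add_left:
  assumes "ess_bounded f" "ess_bounded g"
  shows "mult_op (\<lambda>x. f x + g x) \<xi> = mult_op f \<xi> + mult_op g \<xi>"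
  using assms
  by (transfer, simp add: l2_rel_def ess_bounded_add, simp add: ring_distribs,
      intro sq_integrable_add ess_bounded_mult_sq_integrable; simp)

lemma mult_op_add_right: "mult_op f (\<xi> + \<eta>) = mult_op f \<xi> + mult_op f \<eta>"
proof (transfer, goal_cases)
  case (1 f g h)
  show ?case
  proof (cases "ess_bounded f")
    case True
    with 1 show ?thesis
      by (simp add: l2_rel_def, simp add: ring_distribs,
          intro sq_integrable_add ess_bounded_mult_sq_integrable; simp)
  qed (simp add: l2_rel_def sq_integrable_zero)
qed

lemma mult_op_mult_op:
  assumes "ess_bounded f" "ess_bounded g"
  shows "mult_op f (mult_op g \<xi>) = mult_op (\<lambda>x. f x * g x) \<xi>"
  using assms
  by (transfer, simp add: l2_rel_def ess_bounded_mult, simp add: mult.assoc,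
      intro ess_bounded_mult_sq_integrable; simp)

lemma mult_op_const: "mult_op (\<lambda>_. c) \<xi> = l2_scale c \<xi>"
  by transfer (auto simp: l2_rel_def sq_integrable_scale)

lemma mult_op_zero_left [simp]: "mult_op (\<lambda>_. 0) \<xi> = 0"
  by transfer (auto simp: l2_rel_def sq_integrable_zero)

lemma mult_op_one [simp]: "mult_op (\<lambda>_. 1) \<xi> = \<xi>"
  by transfer (auto simp: l2_rel_def)

lemma mult_op_zero_right [simp]: "mult_op f 0 = 0"
  using mult_op_add_right[of f 0 0] by simp

lemma mult_op_sum_right: "mult_op f (sum g I) = (\<Sum>i\<in>I. mult_op f (g i))"
  by (induction I rule: infinite_finite_induct) (auto simp: mult_op_add_right)

lemma mult_op_sum_left:
  "(\<And>i. i \<in> I \<Longrightarrow> ess_bounded (f i)) \<Longrightarrow> mult_op (\<lambda>x. \<Sum>i\<in>I. f i x) \<xi> = (\<Sum>i\<in>I. mult_op (f i) \<xi>)"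
  by (induction I rule: infinite_finite_induct) (auto simp: mult_op_add_left ess_bounded_sum)

text \<open>Since the measure is finite, the constant 1 is a vector of L^2, and
  \<open>mult_op f\<close> sends it to the class of \<open>f\<close>; a multiplication operator thus
  determines its symbol up to null sets.\<close>

lemma mult_op_eq_iff:
  assumes "ess_bounded f" "ess_bounded g"
  shows "mult_op f = mult_op g \<longleftrightarrow> (AE x in circle_measure. f x = g x)"
proof
  assume *: "mult_op f = mult_op g"
  have one: "sq_integrable (\<lambda>_. 1)"
    by (auto simp: sq_integrable_def)
  define e where "e = abs_l2 (\<lambda>_. 1)"
  have eq: "mult_op h e = abs_l2 (\<lambda>x. h x)" if "ess_bounded h" for h
    unfolding e_def using that one by (subst mult_op.abs_eq) (auto simp: l2_rel_def)
  have "l2_rel h h" if "ess_bounded h" for h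
    using ess_bounded_mult_sq_integrable[OF that one] by (simp add: l2_rel_def)
  with assms eq * show "AE x in circle_measure. f x = g x"
    using Quotient_rel[OF Quotient_l2, of f g] eq[of f] eq[of g] by (simp add: l2_rel_def)
next
  assume *: "AE x in circle_measure. f x = g x"
  have "mult_op f \<xi> = mult_op g \<xi>" for \<xi>
    using assms * by transfer (auto simp: l2_rel_def ess_bounded_mult_sq_integrable elim!: eventually_mono)
  then show "mult_op f = mult_op g" by blast
qed

lemma l2_translate_add: "l2_translate a (\<xi> + \<eta>) = l2_translate a \<xi> + l2_translate a \<eta>"
  by transfer (simp add: l2_rel_def, intro sq_integrable_add; rule sq_integrable_translate)

lemma l2_translate_zero [simp]: "l2_translate a 0 = 0"
  using l2_translate_add[of a 0 0] by simp

lemma l2_translate_sum: "l2_translate a (sum g I) = (\<Sum>i\<in>I. l2_translate a (g i))"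
  by (induction I rule: infinite_finite_induct) (auto simp: l2_translate_add)

lemma l2_translate_translate: "l2_translate a (l2_translate b \<xi>) = l2_translate (a + b) \<xi>"
proof transfer
  fix a b and f :: "circle \<Rightarrow> complex"
  assume "l2_rel f f"
  then show "l2_rel (\<lambda>x. f (x - a - b)) (\<lambda>x. f (x - (a + b)))"
    using sq_integrable_translate[of f "a + b"] by (simp add: l2_rel_def diff_diff_eq)
qed

lemma l2_translate_0 [simp]: "l2_translate 0 \<xi> = \<xi>"
  by transfer (simp add: l2_rel_def)

lemma l2_translate_mult_op:
  assumes f: "ess_bounded f"
  shows "l2_translate a (mult_op f \<xi>) = mult_op (\<lambda>x. f (x - a)) (l2_translate a \<xi>)"
  using f
proof transfer
  fix a and f g :: "circle \<Rightarrow> complex"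
  assume f: "ess_bounded f" and "l2_rel g g"
  then have "sq_integrable (\<lambda>x. f (x - a) * g (x - a))"
    by (intro ess_bounded_mult_sq_integrable ess_bounded_translate[OF f] sq_integrable_translate[of g])
      (auto simp: l2_rel_def)
  then show "l2_rel (\<lambda>x. if ess_bounded f then f (x - a) * g (x - a) else 0)
      (\<lambda>x. if ess_bounded (\<lambda>x. f (x - a)) then f (x - a) * g (x - a) else 0)"
    by (simp add: l2_rel_def f ess_bounded_translate[OF f])
qed

lemma l2_inner_add_left: "l2_inner (\<xi> + \<eta>) \<zeta> = l2_inner \<xi> \<zeta> + l2_inner \<eta> \<zeta>"
  by transfer (auto simp: l2_rel_def ring_distribs integrable_circle_mult)

lemma l2_inner_add_right: "l2_inner \<zeta> (\<xi> + \<eta>) = l2_inner \<zeta> \<xi> + l2_inner \<zeta> \<eta>"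
  by transfer (auto simp: l2_rel_def ring_distribs integrable_circle_mult)

lemma l2_inner_zero_left [simp]: "l2_inner 0 \<zeta> = 0"
  using l2_inner_add_left[of 0 0] by simp

lemma l2_inner_zero_right [simp]: "l2_inner \<zeta> 0 = 0"
  using l2_inner_add_right[of \<zeta> 0 0] by simp

lemma l2_inner_diff_right: "l2_inner \<zeta> (\<xi> - \<eta>) = l2_inner \<zeta> \<xi> - l2_inner \<zeta> \<eta>"
  using l2_inner_add_right[of \<zeta> "\<xi> - \<eta>" \<eta>] by simp

lemma l2_inner_sum_left: "l2_inner (sum g I) \<zeta> = (\<Sum>i\<in>I. l2_inner (g i) \<zeta>)"
  by (induction I rule: infinite_finite_induct) (auto simp: l2_inner_add_left)

lemma l2_inner_sum_right: "l2_inner \<zeta> (sum g I) = (\<Sum>i\<in>I. l2_inner \<zeta> (g i))"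
  by (induction I rule: infinite_finite_induct) (auto simp: l2_inner_add_right)

lemma l2_inner_mult_op:
  "ess_bounded f \<Longrightarrow> l2_inner (mult_op f \<xi>) \<eta> = l2_inner \<xi> (mult_op (\<lambda>x. cnj (f x)) \<eta>)"
  by transfer (simp add: ess_bounded_cnj ac_simps)

text \<open>This is translation invariance of the measure: substituting \<open>x - a\<close> for
  \<open>x\<close> moves the translation to the other factor, so the adjoint of a translation is its
  inverse.\<close>

lemma l2_inner_translate: "l2_inner (l2_translate a \<xi>) \<eta> = l2_inner \<xi> (l2_translate (- a) \<eta>)"
proof transfer
  fix a and f g :: "circle \<Rightarrow> complex"
  assume "l2_rel f f" "l2_rel g g"
  then have [measurable]: "f \<in> borel_measurable borel" "g \<in> borel_measurable borel"
    by (auto simp: l2_rel_def sq_integrable_def cong: measurable_cong_sets)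
  have "(\<integral>x. f x * cnj (g (x - - a)) \<partial>circle_measure) = (\<integral>x. f x * cnj (g (x - - a)) \<partial>distr circle_measure borel (\<lambda>x. x - a))"
    by (simp add: distr_circle_translate)
  also have "\<dots> = (\<integral>x. f (x - a) * cnj (g x) \<partial>circle_measure)"
    using measurable_circle_translate[of "- a"] by (subst integral_distr) simp_all
  finally show "(\<integral>x. f (x - a) * cnj (g x) \<partial>circle_measure) = (\<integral>x. f x * cnj (g (x - - a)) \<partial>circle_measure)"
    by simp
qed

lemma l2_inner_self_eq_0: "l2_inner \<xi> \<xi> = 0 \<Longrightarrow> \<xi> = 0"
proof transfer
  fix f :: "circle \<Rightarrow> complex"
  assume f: "l2_rel f f" and "(\<integral>x. f x * cnj (f x) \<partial>circle_measure) = 0"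
  then have "complex_of_real (\<integral>x. (norm (f x))\<^sup>2 \<partial>circle_measure) = 0"
    by (simp only: complex_norm_square integral_complex_of_real[symmetric])
  then have "AE x in circle_measure. (norm (f x))\<^sup>2 = 0"
    using f by (subst (asm) of_real_eq_0_iff, subst (asm) integral_nonneg_eq_0_iff_AE) (auto simp: l2_rel_def sq_integrable_def)
  then show "l2_rel f (\<lambda>_. 0)"
    using f by (auto simp: l2_rel_def sq_integrable_zero)
qed


subsection \<open>Matrix-valued functions acting on $L^2(\mathbb{T}) \otimes \mathbb{C}^n$\<close>

text \<open>Only domain and range are fixed: being extensional, two elements are equal once they
  agree on vectors. Linearity is not included and is required separately where it matters.\<close>

definition opers :: "nat \<Rightarrow> oper set"
  where "opers n = l2_tensor n \<rightarrow>\<^sub>E l2_tensor n"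

type_synonym mat_fun = "nat \<Rightarrow> nat \<Rightarrow> circle \<Rightarrow> complex"

definition mat_bounded :: "nat \<Rightarrow> mat_fun \<Rightarrow> bool"
  where "mat_bounded n F \<longleftrightarrow> (\<forall>i<n. \<forall>j<n. ess_bounded (F i j))"

definition Mop :: "nat \<Rightarrow> mat_fun \<Rightarrow> oper"
  where "Mop n F = (\<lambda>\<xi>\<in>l2_tensor n. Matrix.vec n (\<lambda>i. \<Sum>j<n. mult_op (F i j) (\<xi> $ j)))"

definition Trans :: "nat \<Rightarrow> circle \<Rightarrow> oper"
  where "Trans n a = (\<lambda>\<xi>\<in>l2_tensor n. map_vec (l2_translate a) \<xi>)"

definition mat_prod :: "nat \<Rightarrow> mat_fun \<Rightarrow> mat_fun \<Rightarrow> mat_fun"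
  where "mat_prod n F G = (\<lambda>i j x. \<Sum>k<n. F i k x * G k j x)"

definition mat_adj :: "mat_fun \<Rightarrow> mat_fun"
  where "mat_adj F = (\<lambda>i j x. cnj (F j i x))"

definition mat_shift :: "circle \<Rightarrow> mat_fun \<Rightarrow> mat_fun"
  where "mat_shift a F = (\<lambda>i j x. F i j (x - a))"

lemma opersD: "T \<in> opers n \<Longrightarrow> \<xi> \<in> l2_tensor n \<Longrightarrow> T \<xi> \<in> l2_tensor n"
  by (auto simp: opers_def)

lemma opers_eqI:
  "S \<in> opers n \<Longrightarrow> T \<in> opers n \<Longrightarrow> (\<And>\<xi>. \<xi> \<in> l2_tensor n \<Longrightarrow> S \<xi> = T \<xi>) \<Longrightarrow> S = T"
  unfolding opers_def by (rule PiE_ext)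

lemma op_mult_in_opers [intro]: "S \<in> opers n \<Longrightarrow> T \<in> opers n \<Longrightarrow> op_mult n S T \<in> opers n"
  by (auto simp: opers_def op_mult_def compose_def)

lemma op_add_in_opers [intro]: "S \<in> opers n \<Longrightarrow> T \<in> opers n \<Longrightarrow> op_add n S T \<in> opers n"
  by (auto simp: opers_def op_add_def PiE_def Pi_def intro!: add_carrier_vec)

lemma op_scale_in_opers [intro]: "T \<in> opers n \<Longrightarrow> op_scale n c T \<in> opers n"
  by (auto simp: opers_def op_scale_def)

lemma Mop_in_opers [intro, simp]: "Mop n F \<in> opers n"
  by (auto simp: opers_def Mop_def)

lemma Trans_in_opers [intro, simp]: "Trans n a \<in> opers n"
  by (auto simp: opers_def Trans_def)

lemma op_one_in_opers [intro, simp]: "op_one n \<in> opers n"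
  by (auto simp: opers_def op_one_def)

lemma op_mult_apply: "\<xi> \<in> l2_tensor n \<Longrightarrow> op_mult n S T \<xi> = S (T \<xi>)"
  by (simp add: op_mult_def compose_def)

text \<open>Nondegeneracy of the inner product. The probe is the vector whose only entry is the
  difference \<delta> of the two \<open>i\<close>-th coordinates, which yields
  \<open>l2_inner \<delta> \<delta> = 0\<close>.\<close>

lemma inner_tensor_eqD:
  assumes "\<zeta> \<in> l2_tensor n" "\<zeta>' \<in> l2_tensor n"
    and "\<And>\<xi>. \<xi> \<in> l2_tensor n \<Longrightarrow> inner_tensor n \<xi> \<zeta> = inner_tensor n \<xi> \<zeta>'"
  shows "\<zeta> = \<zeta>'"
proof (rule eq_vecI)
  fix i assume "i < dim_vec \<zeta>'"
  with assms have i: "i < n" by auto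
  define \<delta> where "\<delta> = \<zeta> $ i - \<zeta>' $ i"
  have "inner_tensor n (Matrix.vec n (\<lambda>j. if j = i then \<delta> else 0)) \<eta> = l2_inner \<delta> (\<eta> $ i)" for \<eta>
  proof -
    have "(\<Sum>j<n. l2_inner (if j = i then \<delta> else 0) (\<eta> $ j)) =
        (\<Sum>j<n. if j = i then l2_inner \<delta> (\<eta> $ j) else 0)"
      by (rule sum.cong) auto
    then show ?thesis using i by (simp add: inner_tensor_def)
  qed
  with assms(3)[of "Matrix.vec n (\<lambda>j. if j = i then \<delta> else 0)"]
  have "l2_inner \<delta> (\<zeta> $ i) = l2_inner \<delta> (\<zeta>' $ i)" by simp
  then have "l2_inner \<delta> \<delta> = 0" by (subst (2) \<delta>_def) (simp add: l2_inner_diff_right)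
  then show "\<zeta> $ i = \<zeta>' $ i"
    using l2_inner_self_eq_0[of \<delta>] by (simp add: \<delta>_def)
qed (use assms in auto)

text \<open>\<open>op_adjoint\<close> is a definite description and can be evaluated only once
  existence and uniqueness are known: \<open>S\<close> supplies the former, nondegeneracy the
  latter. Off the carrier both sides are \<open>undefined\<close> by extensionality.\<close>

lemma op_adjointI:
  assumes "S \<in> opers n"
    and "\<And>\<xi> \<eta>. \<xi> \<in> l2_tensor n \<Longrightarrow> \<eta> \<in> l2_tensor n \<Longrightarrow> inner_tensor n (T \<xi>) \<eta> = inner_tensor n \<xi> (S \<eta>)"
  shows "op_adjoint n T = S"
proof
  fix \<eta>
  show "op_adjoint n T \<eta> = S \<eta>"
  proof (cases "\<eta> \<in> l2_tensor n")
    case True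
    have "(THE \<zeta>. \<zeta> \<in> l2_tensor n \<and>
      (\<forall>\<xi>\<in>l2_tensor n. inner_tensor n (T \<xi>) \<eta> = inner_tensor n \<xi> \<zeta>)) = S \<eta>"
      using assms True
      by (intro the_equality) (auto simp: opersD intro!: inner_tensor_eqD)
    with True show ?thesis by (simp add: op_adjoint_def)
  next
    case False
    with assms(1) show ?thesis by (auto simp: op_adjoint_def opers_def PiE_def extensional_def)
  qed
qed

lemma Mop_apply: "\<xi> \<in> l2_tensor n \<Longrightarrow> i < n \<Longrightarrow> Mop n F \<xi> $ i = (\<Sum>j<n. mult_op (F i j) (\<xi> $ j))"
  by (simp add: Mop_def)

lemma Trans_apply: "\<xi> \<in> l2_tensor n \<Longrightarrow> i < n \<Longrightarrow> Trans n a \<xi> $ i = l2_translate a (\<xi> $ i)"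
  by (simp add: Trans_def)

lemma opers_eqI_index:
  assumes "S \<in> opers n" "T \<in> opers n"
    and "\<And>\<xi> i. \<xi> \<in> l2_tensor n \<Longrightarrow> i < n \<Longrightarrow> S \<xi> $ i = T \<xi> $ i"
  shows "S = T"
proof (rule opers_eqI[OF assms(1,2)])
  fix \<xi> assume "\<xi> \<in> l2_tensor n"
  then show "S \<xi> = T \<xi>"
    using assms(3)[of \<xi>] opersD[OF assms(1), of \<xi>] opersD[OF assms(2), of \<xi>]
    by (intro eq_vecI) auto
qed

lemma Mop_cong:
  assumes "\<And>i j. i < n \<Longrightarrow> j < n \<Longrightarrow> F i j = G i j"
  shows "Mop n F = Mop n G"
  by (rule opers_eqI_index) (auto simp: Mop_apply assms)

text \<open>A vector concentrated in position \<open>j\<close>, read off in coordinate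
  \<open>i\<close>, isolates a single entry and reduces the claim to multiplication operators. This
  is the bridge from operator equations to equations almost everywhere.\<close>

lemma Mop_eq_iff:
  assumes "mat_bounded n F" "mat_bounded n G"
  shows "Mop n F = Mop n G \<longleftrightarrow> (\<forall>i<n. \<forall>j<n. AE x in circle_measure. F i j x = G i j x)"
proof
  assume eq: "Mop n F = Mop n G"
  show "\<forall>i<n. \<forall>j<n. AE x in circle_measure. F i j x = G i j x"
  proof (intro allI impI)
    fix i j assume ij: "i < n" "j < n"
    have "mult_op (F i j) \<eta> = mult_op (G i j) \<eta>" for \<eta>
    proof -
      have "Mop n H (Matrix.vec n (\<lambda>k. if k = j then \<eta> else 0)) $ i = mult_op (H i j) \<eta>" for H
      proof -
        have "mult_op (H i k) (if k = j then \<eta> else 0) = (if k = j then mult_op (H i k) \<eta> else 0)" for k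
          by simp
        then show ?thesis using ij by (simp add: Mop_apply)
      qed
      with eq show ?thesis by metis
    qed
    then have "mult_op (F i j) = mult_op (G i j)" by blast
    then show "AE x in circle_measure. F i j x = G i j x"
      using assms ij by (subst (asm) mult_op_eq_iff) (auto simp: mat_bounded_def)
  qed
next
  assume *: "\<forall>i<n. \<forall>j<n. AE x in circle_measure. F i j x = G i j x"
  have eq: "mult_op (F i j) = mult_op (G i j)" if "i < n" "j < n" for i j
    using that assms * by (subst mult_op_eq_iff) (auto simp: mat_bounded_def)
  show "Mop n F = Mop n G"
    by (rule opers_eqI_index) (auto simp: Mop_apply eq)
qed

lemma mat_bounded_prod [intro]: "mat_bounded n F \<Longrightarrow> mat_bounded n G \<Longrightarrow> mat_bounded n (mat_prod n F G)"
  unfolding mat_bounded_def mat_prod_def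
  by (intro allI impI ess_bounded_sum ess_bounded_mult) simp_all

lemma mat_bounded_adj [intro]: "mat_bounded n F \<Longrightarrow> mat_bounded n (mat_adj F)"
  unfolding mat_bounded_def mat_adj_def by (intro allI impI ess_bounded_cnj) simp

lemma mat_bounded_shift [intro]: "mat_bounded n F \<Longrightarrow> mat_bounded n (mat_shift a F)"
  unfolding mat_bounded_def mat_shift_def by (simp add: ess_bounded_translate)

lemma op_add_Mop:
  assumes "mat_bounded n F" "mat_bounded n G"
  shows "op_add n (Mop n F) (Mop n G) = Mop n (\<lambda>i j x. F i j x + G i j x)"
  using assms
  by (intro opers_eqI_index[of _ n] op_add_in_opers Mop_in_opers)
    (simp_all add: op_add_def Mop_def mult_op_add_left mat_bounded_def sum.distrib)

lemma op_mult_Mop: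
  assumes F: "mat_bounded n F" and G: "mat_bounded n G"
  shows "op_mult n (Mop n F) (Mop n G) = Mop n (mat_prod n F G)"
proof (intro opers_eqI_index[of _ n] op_mult_in_opers Mop_in_opers)
  fix \<xi> i assume \<xi>: "\<xi> \<in> l2_tensor n" and i: "i < n"
  have "op_mult n (Mop n F) (Mop n G) \<xi> $ i =
      (\<Sum>k<n. mult_op (F i k) (\<Sum>j<n. mult_op (G k j) (\<xi> $ j)))"
    using \<xi> i by (simp add: op_mult_apply Mop_apply opersD[OF Mop_in_opers])
  also have "\<dots> = (\<Sum>k<n. \<Sum>j<n. mult_op (\<lambda>x. F i k x * G k j x) (\<xi> $ j))"
    using F G i by (intro sum.cong) (auto simp: mult_op_sum_right mult_op_mult_op mat_bounded_def)
  also have "\<dots> = (\<Sum>j<n. \<Sum>k<n. mult_op (\<lambda>x. F i k x * G k j x) (\<xi> $ j))"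
    by (rule sum.swap)
  also have "\<dots> = (\<Sum>j<n. mult_op (\<lambda>x. \<Sum>k<n. F i k x * G k j x) (\<xi> $ j))"
    using F G i by (intro sum.cong refl mult_op_sum_left[symmetric] ess_bounded_mult)
      (auto simp: mat_bounded_def)
  finally show "op_mult n (Mop n F) (Mop n G) \<xi> $ i = Mop n (mat_prod n F G) \<xi> $ i"
    using \<xi> i by (simp add: Mop_apply mat_prod_def)
qed

lemma inner_tensor_Mop:
  assumes F: "mat_bounded n F" and \<xi>: "\<xi> \<in> l2_tensor n" and \<eta>: "\<eta> \<in> l2_tensor n"
  shows "inner_tensor n (Mop n F \<xi>) \<eta> = inner_tensor n \<xi> (Mop n (mat_adj F) \<eta>)"
proof -
  have "inner_tensor n (Mop n F \<xi>) \<eta> = (\<Sum>i<n. \<Sum>j<n. l2_inner (mult_op (F i j) (\<xi> $ j)) (\<eta> $ i))"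
    using \<xi> by (simp add: inner_tensor_def Mop_apply l2_inner_sum_left)
  also have "\<dots> = (\<Sum>i<n. \<Sum>j<n. l2_inner (\<xi> $ j) (mult_op (mat_adj F j i) (\<eta> $ i)))"
    using F by (intro sum.cong) (auto simp: l2_inner_mult_op mat_bounded_def mat_adj_def)
  also have "\<dots> = (\<Sum>j<n. \<Sum>i<n. l2_inner (\<xi> $ j) (mult_op (mat_adj F j i) (\<eta> $ i)))"
    by (rule sum.swap)
  also have "\<dots> = inner_tensor n \<xi> (Mop n (mat_adj F) \<eta>)"
    using \<eta> by (simp add: inner_tensor_def Mop_apply l2_inner_sum_right)
  finally show ?thesis .
qed

lemma inner_tensor_Trans:
  assumes \<xi>: "\<xi> \<in> l2_tensor n" and \<eta>: "\<eta> \<in> l2_tensor n"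
  shows "inner_tensor n (Trans n a \<xi>) \<eta> = inner_tensor n \<xi> (Trans n (- a) \<eta>)"
  using assms by (simp add: inner_tensor_def Trans_apply l2_inner_translate)

lemma op_mult_Trans_Trans: "op_mult n (Trans n a) (Trans n b) = Trans n (a + b)"
  by (intro opers_eqI_index[of _ n] op_mult_in_opers Trans_in_opers)
    (simp add: op_mult_apply Trans_apply opersD[OF Trans_in_opers] l2_translate_translate)

lemma Trans_0: "Trans n 0 = op_one n"
  by (intro opers_eqI_index[of _ n] Trans_in_opers op_one_in_opers) (simp add: Trans_apply op_one_def)

text \<open>The covariance relation: a translation moves past a matrix function at the cost of
  translating the argument of that function.\<close>

lemma op_mult_Trans_Mop:
  assumes "mat_bounded n F"
  shows "op_mult n (Trans n a) (Mop n F) = op_mult n (Mop n (mat_shift a F)) (Trans n a)"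
  using assms
  by (intro opers_eqI_index[of _ n] op_mult_in_opers Trans_in_opers Mop_in_opers)
    (auto simp: op_mult_apply Trans_apply Mop_apply opersD[OF Trans_in_opers]
      opersD[OF Mop_in_opers] l2_translate_sum l2_translate_mult_op mat_shift_def mat_bounded_def
      intro!: sum.cong)

lemma op_tensor_mult_op:
  assumes "ess_bounded f"
  shows "op_tensor n (mult_op f) a = Mop n (\<lambda>i j x. a $$ (i, j) * f x)"
proof (rule opers_eqI_index)
  show "op_tensor n (mult_op f) a \<in> opers n" by (auto simp: opers_def op_tensor_def)
qed (use assms in \<open>auto simp: op_tensor_def Mop_apply mult_op_mult_op simp flip: mult_op_const\<close>)

lemma op_tensor_l2_translate: "op_tensor n (l2_translate a) (1\<^sub>m n) = Trans n a"
proof (rule opers_eqI_index)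
  show "op_tensor n (l2_translate a) (1\<^sub>m n) \<in> opers n" by (auto simp: opers_def op_tensor_def)
next
  fix \<xi> i assume \<xi>: "\<xi> \<in> l2_tensor n" and i: "i < n"
  have "l2_scale (1\<^sub>m n $$ (i, j)) \<eta> = (if j = i then \<eta> else 0)" if "j < n" for j \<eta>
    using i that by (auto simp flip: mult_op_const)
  then show "op_tensor n (l2_translate a) (1\<^sub>m n) \<xi> $ i = Trans n a \<xi> $ i"
    using \<xi> i by (simp add: op_tensor_def Trans_apply)
qed simp

lemma op_scale_one: "op_scale n c (op_one n) = Mop n (\<lambda>i j x. if i = j then c else 0)"
proof (intro opers_eqI_index[of _ n] op_scale_in_opers op_one_in_opers Mop_in_opers)
  fix \<xi> i assume \<xi>: "\<xi> \<in> l2_tensor n" and i: "i < n"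
  have "mult_op (\<lambda>x. if i = j then c else 0) \<eta> = (if j = i then l2_scale c \<eta> else 0)" for j \<eta>
    by (auto simp flip: mult_op_const)
  then show "op_scale n c (op_one n) \<xi> $ i = Mop n (\<lambda>i j x. if i = j then c else 0) \<xi> $ i"
    using \<xi> i by (simp add: op_scale_def op_one_def Mop_apply)
qed

lemma op_one_eq_Mop: "op_one n = Mop n (\<lambda>i j x. if i = j then 1 else 0)"
proof -
  have "op_scale n 1 (op_one n) = op_one n"
    by (intro opers_eqI_index[of _ n] op_scale_in_opers op_one_in_opers)
      (simp add: op_scale_def op_one_def flip: mult_op_const)
  then show ?thesis by (simp add: op_scale_one)
qed

text \<open>A matrix function is the sum of its \<open>n * n\<close> entries, each the elementary
  tensor of \<open>F k l\<close> with a matrix unit. The sum is built up one index pair at a time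
  because the span is closed under binary addition.\<close>

lemma Linf_tensor_M_eq: "Linf_tensor_M n = Mop n ` {F. mat_bounded n F}"
proof (intro equalityI subsetI)
  fix T assume "T \<in> Linf_tensor_M n"
  then show "T \<in> Mop n ` {F. mat_bounded n F}"
  proof induction
    case (elementary f a)
    have "mat_bounded n (\<lambda>i j x. a $$ (i, j) * f x)"
      using elementary by (auto simp: mat_bounded_def intro!: ess_bounded_mult)
    then show ?case using elementary by (auto simp: op_tensor_mult_op)
  next
    case (add S T)
    then obtain F G where "S = Mop n F" "T = Mop n G" "mat_bounded n F" "mat_bounded n G"
      by auto
    moreover from this have "mat_bounded n (\<lambda>i j x. F i j x + G i j x)"
      by (auto simp: mat_bounded_def intro!: ess_bounded_add)
    ultimately show ?case by (auto simp: op_add_Mop)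
  qed
next
  fix T assume "T \<in> Mop n ` {F. mat_bounded n F}"
  then obtain F where T: "T = Mop n F" and F: "mat_bounded n F" by auto
  have "Mop n (\<lambda>i j x. if (i, j) \<in> I then F i j x else 0) \<in> Linf_tensor_M n"
    if "finite I" "I \<subseteq> {..<n} \<times> {..<n}" for I
    using that
  proof (induction I rule: finite_induct)
    case empty
    \<comment> \<open>The span has no rule for 0, so the empty sum is produced as an elementary
      tensor.\<close>
    have "op_tensor n (mult_op (\<lambda>_. 0)) (0\<^sub>m n n) \<in> Linf_tensor_M n"
      by (intro Linf_tensor_M.elementary) auto
    then show ?case by (simp add: op_tensor_mult_op)
  next
    case (insert p I)
    obtain k l where p: "p = (k, l)" and kl: "k < n" "l < n"
      using insert.prems by (cases p) auto
    \<comment> \<open>The matrix unit at \<open>(k, l)\<close>.\<close>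
    define E where "E = Matrix.mat n n (\<lambda>q. if q = p then 1 else 0 :: complex)"
    have bd: "ess_bounded (F k l)" using F kl by (auto simp: mat_bounded_def)
    then have "op_tensor n (mult_op (F k l)) E \<in> Linf_tensor_M n"
      by (intro Linf_tensor_M.elementary) (auto simp: E_def)
    then have 1: "op_add n (op_tensor n (mult_op (F k l)) E)
        (Mop n (\<lambda>i j x. if (i, j) \<in> I then F i j x else 0)) \<in> Linf_tensor_M n"
      using insert by (intro Linf_tensor_M.add) auto
    have "mat_bounded n (\<lambda>i j x. E $$ (i, j) * F k l x)"
      using bd by (auto simp: mat_bounded_def intro!: ess_bounded_mult)
    moreover have "mat_bounded n (\<lambda>i j x. if (i, j) \<in> I then F i j x else 0)"
      unfolding mat_bounded_def
    proof (intro allI impI)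
      fix i j assume "i < n" "j < n"
      with F show "ess_bounded (\<lambda>x. if (i, j) \<in> I then F i j x else 0)"
        by (cases "(i, j) \<in> I") (auto simp: mat_bounded_def)
    qed
    ultimately have "op_add n (op_tensor n (mult_op (F k l)) E)
        (Mop n (\<lambda>i j x. if (i, j) \<in> I then F i j x else 0)) =
        Mop n (\<lambda>i j x. E $$ (i, j) * F k l x + (if (i, j) \<in> I then F i j x else 0))"
      using bd by (simp add: op_tensor_mult_op op_add_Mop)
    also have "\<dots> = Mop n (\<lambda>i j x. if (i, j) \<in> insert p I then F i j x else 0)"
      using insert.hyps by (intro Mop_cong ext) (auto simp: E_def p)
    finally show ?case using 1 by simp
  qed
  from this[of "{..<n} \<times> {..<n}"]
  have "Mop n (\<lambda>i j x. if (i, j) \<in> {..<n} \<times> {..<n} then F i j x else 0) \<in> Linf_tensor_M n"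
    by simp
  also have "Mop n (\<lambda>i j x. if (i, j) \<in> {..<n} \<times> {..<n} then F i j x else 0) = T"
    unfolding T by (rule Mop_cong) simp
  finally show "T \<in> Linf_tensor_M n" .
qed


subsection \<open>Unitary implementation of automorphisms\<close>

text \<open>\<open>U'\<close> is at once the inverse and the adjoint of \<open>U\<close>. Linearity
  of \<open>U\<close> is listed because membership in \<open>opers\<close> does not provide
  it.\<close>

locale unitary_op =
  fixes n :: nat and U U' :: oper
  assumes U_opers: "U \<in> opers n" and U'_opers: "U' \<in> opers n"
    and U_U': "\<xi> \<in> l2_tensor n \<Longrightarrow> U (U' \<xi>) = \<xi>"
    and U'_U: "\<xi> \<in> l2_tensor n \<Longrightarrow> U' (U \<xi>) = \<xi>"
    and inner_U: "\<xi> \<in> l2_tensor n \<Longrightarrow> \<eta> \<in> l2_tensor n \<Longrightarrow> inner_tensor n (U \<xi>) \<eta> = inner_tensor n \<xi> (U' \<eta>)"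
    and U_add: "\<xi> \<in> l2_tensor n \<Longrightarrow> \<eta> \<in> l2_tensor n \<Longrightarrow> U (\<xi> + \<eta>) = U \<xi> + U \<eta>"
    and U_scale: "\<xi> \<in> l2_tensor n \<Longrightarrow> U (map_vec (l2_scale c) \<xi>) = map_vec (l2_scale c) (U \<xi>)"
begin

lemma op_adjoint_U: "op_adjoint n U = U'"
  by (rule op_adjointI[OF U'_opers inner_U])

lemma Ad_in_opers: "T \<in> opers n \<Longrightarrow> Ad n U T \<in> opers n"
  unfolding Ad_def op_adjoint_U by (intro op_mult_in_opers U_opers U'_opers)

lemma Ad_apply: "\<xi> \<in> l2_tensor n \<Longrightarrow> Ad n U T \<xi> = U (T (U' \<xi>))"
  by (simp add: Ad_def op_adjoint_U op_mult_apply opersD[OF U'_opers])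

lemma inner_U': "\<xi> \<in> l2_tensor n \<Longrightarrow> \<eta> \<in> l2_tensor n \<Longrightarrow> inner_tensor n (U' \<xi>) \<eta> = inner_tensor n \<xi> (U \<eta>)"
  using inner_U[of "U' \<xi>" "U \<eta>"] by (simp add: opersD[OF U_opers] opersD[OF U'_opers] U_U' U'_U)

lemmas in_tensor = opersD[OF U_opers] opersD[OF U'_opers]

text \<open>Invariance of \<open>A\<close> under conjugation in both directions gives bijectivity.
  Existence of an adjoint \<open>S\<close> for every \<open>T\<close> is assumed because
  \<open>op_adjoint\<close> is a definite description; the adjoint of the conjugate is then the
  conjugate of \<open>S\<close>.\<close>

lemma star_automorphism_Ad:
  assumes A: "A \<subseteq> opers n"
    and Ad: "\<And>T. T \<in> A \<Longrightarrow> Ad n U T \<in> A"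
    and Ad': "\<And>T. T \<in> A \<Longrightarrow> op_mult n (op_mult n U' T) U \<in> A"
    and adj: "\<And>T. T \<in> A \<Longrightarrow> \<exists>S\<in>opers n. \<forall>\<xi>\<in>l2_tensor n. \<forall>\<eta>\<in>l2_tensor n.
      inner_tensor n (T \<xi>) \<eta> = inner_tensor n \<xi> (S \<eta>)"
  shows "star_automorphism n A (Ad n U)"
  unfolding star_automorphism_def
proof (intro conjI ballI allI)
  show "bij_betw (Ad n U) A A"
  proof (rule bij_betwI)
    show "Ad n U \<in> A \<rightarrow> A" "(\<lambda>T. op_mult n (op_mult n U' T) U) \<in> A \<rightarrow> A"
      using Ad Ad' by auto
    fix T assume "T \<in> A"
    then have T: "T \<in> opers n" using A by auto
    then show "op_mult n (op_mult n U' (Ad n U T)) U = T"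
      by (intro opers_eqI[OF _ T] op_mult_in_opers U'_opers U_opers Ad_in_opers)
        (simp_all add: op_mult_apply Ad_apply in_tensor opersD[OF T] U'_U)
    show "Ad n U (op_mult n (op_mult n U' T) U) = T"
      by (intro opers_eqI[OF _ T] op_mult_in_opers U'_opers U_opers Ad_in_opers T)
        (simp add: op_mult_apply Ad_apply in_tensor opersD[OF T] U_U')
  qed
next
  fix S T assume "S \<in> A" "T \<in> A"
  then have S: "S \<in> opers n" and T: "T \<in> opers n" using A by auto
  show "Ad n U (op_add n S T) = op_add n (Ad n U S) (Ad n U T)"
    using S T
    by (intro opers_eqI[of _ n] op_add_in_opers Ad_in_opers)
      (simp_all add: op_add_def Ad_apply in_tensor opersD[OF S] opersD[OF T] U_add)
  show "Ad n U (op_mult n S T) = op_mult n (Ad n U S) (Ad n U T)"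
    using S T
    by (intro opers_eqI[of _ n] op_mult_in_opers Ad_in_opers)
      (simp_all add: op_mult_apply Ad_apply in_tensor opersD[OF S] opersD[OF T] U'_U)
next
  fix c T assume "T \<in> A"
  then have T: "T \<in> opers n" using A by auto
  then show "Ad n U (op_scale n c T) = op_scale n c (Ad n U T)"
    by (intro opers_eqI[of _ n] op_scale_in_opers Ad_in_opers)
      (simp_all add: op_scale_def Ad_apply in_tensor opersD[OF T] U_scale)
next
  fix T assume TA: "T \<in> A"
  then have T: "T \<in> opers n" using A by auto
  obtain S where S: "S \<in> opers n"
    and TS: "\<And>\<xi> \<eta>. \<xi> \<in> l2_tensor n \<Longrightarrow> \<eta> \<in> l2_tensor n \<Longrightarrow> inner_tensor n (T \<xi>) \<eta> = inner_tensor n \<xi> (S \<eta>)"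
    using adj[OF TA] by blast
  have "op_adjoint n (Ad n U T) = Ad n U S"
    by (intro op_adjointI Ad_in_opers S)
      (simp add: Ad_apply inner_U inner_U' TS in_tensor opersD[OF T] opersD[OF S])
  moreover have "op_adjoint n T = S"
    by (rule op_adjointI[OF S TS])
  ultimately show "Ad n U (op_adjoint n T) = op_adjoint n (Ad n U T)" by simp
qed

end

section \<open>Unitaries that are a matrix function times a translation\<close>

lemma Mop_add_right:
  "\<xi> \<in> l2_tensor n \<Longrightarrow> \<eta> \<in> l2_tensor n \<Longrightarrow> Mop n F (\<xi> + \<eta>) = Mop n F \<xi> + Mop n F \<eta>"
  by (rule eq_vecI) (simp_all add: Mop_def mult_op_add_right sum.distrib)

lemma Trans_add_right:
  "\<xi> \<in> l2_tensor n \<Longrightarrow> \<eta> \<in> l2_tensor n \<Longrightarrow> Trans n a (\<xi> + \<eta>) = Trans n a \<xi> + Trans n a \<eta>"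
  by (rule eq_vecI) (simp_all add: Trans_def l2_translate_add)

lemma Mop_scale_right:
  assumes "mat_bounded n F" "\<xi> \<in> l2_tensor n"
  shows "Mop n F (map_vec (l2_scale c) \<xi>) = map_vec (l2_scale c) (Mop n F \<xi>)"
  using assms
  by (intro eq_vecI) (simp_all add: Mop_def mat_bounded_def mult_op_mult_op mult_op_sum_right mult.commute flip: mult_op_const)

lemma Trans_scale_right:
  "\<xi> \<in> l2_tensor n \<Longrightarrow> Trans n a (map_vec (l2_scale c) \<xi>) = map_vec (l2_scale c) (Trans n a \<xi>)"
  by (intro eq_vecI) (simp_all add: Trans_def l2_translate_mult_op flip: mult_op_const)

lemma Mop_Mop:
  assumes "mat_bounded n F" "mat_bounded n G" "\<xi> \<in> l2_tensor n"
  shows "Mop n F (Mop n G \<xi>) = Mop n (mat_prod n F G) \<xi>"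
  using op_mult_Mop[OF assms(1,2)] op_mult_apply[OF assms(3), of "Mop n F" "Mop n G"] by simp

lemma Trans_Mop:
  assumes "mat_bounded n F" "\<xi> \<in> l2_tensor n"
  shows "Trans n a (Mop n F \<xi>) = Mop n (mat_shift a F) (Trans n a \<xi>)"
  using op_mult_Trans_Mop[OF assms(1), of a] op_mult_apply[OF assms(2), of "Trans n a" "Mop n F"]
    op_mult_apply[OF assms(2), of "Mop n (mat_shift a F)" "Trans n a"] by simp

lemma Trans_Trans:
  assumes "\<xi> \<in> l2_tensor n"
  shows "Trans n a (Trans n b \<xi>) = Trans n (a + b) \<xi>"
  using op_mult_Trans_Trans[of n a b] op_mult_apply[OF assms, of "Trans n a" "Trans n b"] by simp

lemma Trans_0_apply: "\<xi> \<in> l2_tensor n \<Longrightarrow> Trans n 0 \<xi> = \<xi>"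
  by (simp add: Trans_0 op_one_def)

text \<open>The unitarity relations are demanded at every point, not just almost everywhere, so that
  they pass to operators by mere congruence of the entries.\<close>

locale unitary_mat_fun =
  fixes n :: nat and w :: mat_fun and a :: circle
  assumes w_bounded: "mat_bounded n w"
    and w_adj: "i < n \<Longrightarrow> j < n \<Longrightarrow> mat_prod n w (mat_adj w) i j x = (if i = j then 1 else 0)"
    and adj_w: "i < n \<Longrightarrow> j < n \<Longrightarrow> mat_prod n (mat_adj w) w i j x = (if i = j then 1 else 0)"
begin

text \<open>\<open>U\<close> is the product WV; \<open>U'\<close> is the product of the adjoints in
  reverse order, the adjoint of a translation being the opposite translation.\<close>

definition "U = op_mult n (Mop n w) (Trans n a)"
definition "U' = op_mult n (Trans n (- a)) (Mop n (mat_adj w))"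

lemmas tensors = opersD[OF Mop_in_opers] opersD[OF Trans_in_opers]

lemma w_adj_apply: "\<xi> \<in> l2_tensor n \<Longrightarrow> Mop n w (Mop n (mat_adj w) \<xi>) = \<xi>"
proof -
  assume "\<xi> \<in> l2_tensor n"
  moreover have "Mop n (mat_prod n w (mat_adj w)) = op_one n"
    unfolding op_one_eq_Mop by (intro Mop_cong ext) (simp add: w_adj)
  ultimately show ?thesis
    using w_bounded by (simp add: Mop_Mop mat_bounded_adj op_one_def)
qed

lemma adj_w_apply: "\<xi> \<in> l2_tensor n \<Longrightarrow> Mop n (mat_adj w) (Mop n w \<xi>) = \<xi>"
proof -
  assume "\<xi> \<in> l2_tensor n"
  moreover have "Mop n (mat_prod n (mat_adj w) w) = op_one n"
    unfolding op_one_eq_Mop by (intro Mop_cong ext) (simp add: adj_w)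
  ultimately show ?thesis
    using w_bounded by (simp add: Mop_Mop mat_bounded_adj op_one_def)
qed

sublocale unitary_op n U U'
proof
  show "U \<in> opers n" "U' \<in> opers n" by (auto simp: U_def U'_def)
  fix \<xi> \<eta> c assume \<xi>: "\<xi> \<in> l2_tensor n"
  show "U (U' \<xi>) = \<xi>"
    using \<xi> by (simp add: U_def U'_def op_mult_apply tensors Trans_Trans Trans_0_apply w_adj_apply)
  show "U' (U \<xi>) = \<xi>"
    using \<xi> by (simp add: U_def U'_def op_mult_apply tensors Trans_Trans Trans_0_apply adj_w_apply)
  show "U (map_vec (l2_scale c) \<xi>) = map_vec (l2_scale c) (U \<xi>)"
    using \<xi> w_bounded
    by (simp add: U_def op_mult_apply tensors Mop_scale_right Trans_scale_right)
  assume \<eta>: "\<eta> \<in> l2_tensor n"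
  show "inner_tensor n (U \<xi>) \<eta> = inner_tensor n \<xi> (U' \<eta>)"
    using \<xi> \<eta> w_bounded
    by (simp add: U_def U'_def op_mult_apply tensors inner_tensor_Mop inner_tensor_Trans)
  show "U (\<xi> + \<eta>) = U \<xi> + U \<eta>"
    using \<xi> \<eta> by (simp add: U_def op_mult_apply tensors Mop_add_right Trans_add_right)
qed

definition "mat_conj F = mat_prod n w (mat_prod n (mat_shift a F) (mat_adj w))"

lemma mat_bounded_mat_conj: "mat_bounded n F \<Longrightarrow> mat_bounded n (mat_conj F)"
  unfolding mat_conj_def using w_bounded by blast

text \<open>By covariance the left translation passes \<open>F\<close>, turning it into
  \<open>mat_shift a F\<close>, and then cancels against the opposite translation. No translation is
  left over, so conjugation preserves matrix functions.\<close>

lemma Ad_Mop: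
  assumes F: "mat_bounded n F"
  shows "Ad n U (Mop n F) = Mop n (mat_conj F)"
proof (rule opers_eqI[OF Ad_in_opers])
  fix \<xi> assume \<xi>: "\<xi> \<in> l2_tensor n"
  have "Ad n U (Mop n F) \<xi> = Mop n w (Trans n a (Mop n F (Trans n (- a) (Mop n (mat_adj w) \<xi>))))"
    unfolding Ad_apply[OF \<xi>] using \<xi> by (simp add: U_def U'_def op_mult_apply tensors)
  also have "\<dots> = Mop n w (Mop n (mat_shift a F) (Mop n (mat_adj w) \<xi>))"
    using \<xi> F by (simp add: Trans_Mop tensors Trans_Trans Trans_0_apply)
  also have "\<dots> = Mop n (mat_conj F) \<xi>"
    unfolding mat_conj_def using \<xi> F w_bounded
    by (simp add: Mop_Mop mat_bounded_adj mat_bounded_prod mat_bounded_shift)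
  finally show "Ad n U (Mop n F) \<xi> = Mop n (mat_conj F) \<xi>" .
qed auto

lemma star_automorphism_Linf: "star_automorphism n (Linf_tensor_M n) (Ad n U)"
proof (rule star_automorphism_Ad)
  show "Linf_tensor_M n \<subseteq> opers n" by (auto simp: Linf_tensor_M_eq)
  fix T assume "T \<in> Linf_tensor_M n"
  then obtain F where T: "T = Mop n F" and F: "mat_bounded n F" by (auto simp: Linf_tensor_M_eq)
  show "Ad n U T \<in> Linf_tensor_M n"
    using F by (auto simp: T Linf_tensor_M_eq Ad_Mop intro: mat_bounded_mat_conj)
  show "\<exists>S\<in>opers n. \<forall>\<xi>\<in>l2_tensor n. \<forall>\<eta>\<in>l2_tensor n.
      inner_tensor n (T \<xi>) \<eta> = inner_tensor n \<xi> (S \<eta>)"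
    using F by (intro bexI[of _ "Mop n (mat_adj F)"]) (auto simp: T inner_tensor_Mop)
  \<comment> \<open>The symbol of the inverse conjugate: undo \<open>w\<close> first, then translate
    back by \<open>- a\<close>.\<close>
  define G where "G = mat_shift (- a) (mat_prod n (mat_adj w) (mat_prod n F w))"
  have G: "mat_bounded n G"
    unfolding G_def using w_bounded F by blast
  have "op_mult n (op_mult n U' T) U = Mop n G"
  proof (rule opers_eqI)
    show "op_mult n (op_mult n U' T) U \<in> opers n"
      by (intro op_mult_in_opers U_opers U'_opers) (simp add: T)
    fix \<xi> assume \<xi>: "\<xi> \<in> l2_tensor n"
    have "op_mult n (op_mult n U' T) U \<xi> =
        Trans n (- a) (Mop n (mat_adj w) (Mop n F (Mop n w (Trans n a \<xi>))))"
      using \<xi> by (simp add: T U_def U'_def op_mult_apply tensors)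
    also have "\<dots> = Trans n (- a) (Mop n (mat_prod n (mat_adj w) (mat_prod n F w)) (Trans n a \<xi>))"
      using \<xi> F w_bounded by (simp add: Mop_Mop tensors mat_bounded_adj mat_bounded_prod)
    also have "\<dots> = Mop n G (Trans n (- a) (Trans n a \<xi>))"
      unfolding G_def using \<xi> F w_bounded
      by (intro Trans_Mop) (simp_all add: tensors mat_bounded_adj mat_bounded_prod)
    also have "\<dots> = Mop n G \<xi>"
      using \<xi> by (simp add: Trans_Trans Trans_0_apply)
    finally show "op_mult n (op_mult n U' T) U \<xi> = Mop n G \<xi>" .
  qed simp
  then show "op_mult n (op_mult n U' T) U \<in> Linf_tensor_M n"
    using G by (auto simp: Linf_tensor_M_eq)
qed

end

subsection \<open>Coordinates and characters on the circle\<close>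

definition coord :: "circle \<Rightarrow> real"
  where "coord x = frac (rep_circle x)"

lemma to_circle_rep: "to_circle (rep_circle x) = x"
  by (rule Quotient_abs_rep[OF Quotient_circle])

lemma to_circle_eq_iff: "to_circle s = to_circle t \<longleftrightarrow> s - t \<in> \<int>"
  using Quotient_rel[OF Quotient_circle, of s t] by simp

lemma to_circle_frac: "to_circle (frac t) = to_circle t"
  using to_circle_add_int[of "frac t" "\<lfloor>t\<rfloor>"] by (simp add: frac_def)

lemma to_circle_coord [simp]: "to_circle (coord x) = x"
  by (simp add: coord_def to_circle_frac to_circle_rep)

lemma coord_bounds: "0 \<le> coord x" "coord x < 1"
  by (simp_all add: coord_def frac_lt_1)

lemma coord_unique:
  assumes "to_circle t = x" "0 \<le> t" "t < 1"
  shows "coord x = t"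
proof -
  have "coord x - t \<in> \<int>" using assms(1) to_circle_eq_iff[of "coord x" t] by simp
  then obtain k where k: "coord x - t = of_int k" by (auto elim: Ints_cases)
  then have "-1 < real_of_int k" "real_of_int k < 1" using coord_bounds[of x] assms by linarith+
  then have "k = 0" by linarith
  with k show ?thesis by simp
qed

lemma coord_to_circle: "coord (to_circle t) = frac t"
  by (rule coord_unique) (simp_all add: to_circle_frac frac_lt_1)

lemma to_circle_diff: "to_circle s - to_circle t = to_circle (s - t)"
  by (simp add: minus_circle.abs_eq)

lemma coord_translate:
  assumes "0 \<le> \<theta>" "\<theta> < 1"
  shows "coord (x - to_circle \<theta>) = (if coord x < \<theta> then coord x - \<theta> + 1 else coord x - \<theta>)"
proof (rule coord_unique)
  have "to_circle (coord x - \<theta>) = x - to_circle \<theta>"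
    using to_circle_diff[of "coord x" \<theta>] by simp
  then show "to_circle (if coord x < \<theta> then coord x - \<theta> + 1 else coord x - \<theta>) = x - to_circle \<theta>"
    using to_circle_add_int[of "coord x - \<theta>" 1] by simp
qed (use assms coord_bounds[of x] in auto)

lemma to_circle_image_Ico:
  assumes "t \<le> 1"
  shows "to_circle ` {0..<t} = {x. coord x < t}"
proof (intro equalityI subsetI)
  fix x assume "x \<in> to_circle ` {0..<t}"
  then obtain s where "x = to_circle s" "0 \<le> s" "s < t" by auto
  with coord_unique[of s x] assms show "x \<in> {x. coord x < t}" by auto
next
  fix x assume "x \<in> {x. coord x < t}"
  then show "x \<in> to_circle ` {0..<t}"
    using coord_bounds[of x] by (intro image_eqI[of _ _ "coord x"]) auto
qed

text \<open>The quotient map is open because the saturation of \<open>S\<close> is the union of its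
  integer translates.\<close>

lemma open_to_circle_image:
  assumes "open S"
  shows "open (to_circle ` S)"
proof -
  have "to_circle -` (to_circle ` S) = (\<Union>k::int. (\<lambda>t. t - of_int k) -` S)"
  proof (intro equalityI subsetI)
    fix t assume "t \<in> to_circle -` (to_circle ` S)"
    then obtain s where s: "s \<in> S" "to_circle t = to_circle s" by auto
    then obtain k where "t - s = of_int k"
      unfolding to_circle_eq_iff by (auto elim: Ints_cases)
    then have "t - of_int k = s" by simp
    with s show "t \<in> (\<Union>k::int. (\<lambda>t. t - of_int k) -` S)" by auto
  next
    fix t assume "t \<in> (\<Union>k::int. (\<lambda>t. t - of_int k) -` S)"
    then obtain k where "t - of_int k \<in> S" by auto
    then show "t \<in> to_circle -` (to_circle ` S)"
      using to_circle_add_int[of "t - of_int k" k] by (metis diff_add_cancel imageI vimageI)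
  qed
  moreover have "open ((\<lambda>t. t - of_int k) -` S)" for k
    using assms by (intro open_vimage continuous_intros) auto
  ultimately show ?thesis by (auto simp: open_circle_def)
qed

lemma borel_measurable_coord [measurable]: "coord \<in> borel_measurable borel"
proof (rule borel_measurableI_less)
  fix y :: real
  have "{x. coord x < y} \<in> sets borel" if y: "0 < y" "y \<le> 1"
  proof -
    have ne: "to_circle 0 \<noteq> to_circle t" if "0 < t" "t < 1" for t
      using coord_unique[of t "to_circle t"] coord_unique[of 0 "to_circle 0"] that by auto
    have "UNIV - to_circle ` {0<..<1} = {to_circle 0}"
    proof (intro equalityI subsetI)
      fix x assume x: "x \<in> UNIV - to_circle ` {0<..<1}"
      have "coord x \<notin> {0<..<1}" using x to_circle_coord[of x] by (metis DiffD2 imageI)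
      then have "coord x = 0" using coord_bounds[of x] by auto
      then show "x \<in> {to_circle 0}" using to_circle_coord[of x] by simp
    next
      fix x assume "x \<in> {to_circle 0}"
      then show "x \<in> UNIV - to_circle ` {0<..<1}" using ne by (simp add: image_iff)
    qed
    moreover have "{x. coord x < y} = {to_circle 0} \<union> to_circle ` {0<..<y}"
    proof -
      have "{0..<y} = insert 0 {0<..<y}" using y by auto
      then show ?thesis unfolding to_circle_image_Ico[OF y(2), symmetric] by simp
    qed
    moreover have "UNIV - to_circle ` {0<..<1} \<in> sets borel" "to_circle ` {0<..<y} \<in> sets borel"
      using open_to_circle_image[of "{0<..<1}"] open_to_circle_image[of "{0<..<y}"]
      by (auto intro!: sets.Diff borel_open simp del: Compl_eq_Diff_UNIV)
    ultimately show ?thesis by (metis sets.Un)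
  qed
  moreover have "{x. coord x < y} = {}" if "y \<le> 0"
    using coord_bounds(1) that by (auto simp: not_less intro: order_trans)
  moreover have "{x. coord x < y} = UNIV" if "1 < y"
    using coord_bounds(2) that by (auto intro: less_trans)
  ultimately show "{x \<in> space borel. coord x < y} \<in> sets borel"
    by (cases "y \<le> 0"; cases "y \<le> 1") auto
qed

section \<open>Characters of the circle\<close>

lemma cis_2pi_eq_1_iff: "cis (2 * pi * t) = 1 \<longleftrightarrow> t \<in> \<int>"
proof
  assume "cis (2 * pi * t) = 1"
  then have "cos (2 * pi * t) = 1" by (simp add: complex_eq_iff)
  then obtain k :: int where "2 * pi * t = of_int k * 2 * pi"
    using cos_one_2pi_int by auto
  then have "t = of_int k" by simp
  then show "t \<in> \<int>" by simp
next
  assume "t \<in> \<int>"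
  then show "cis (2 * pi * t) = 1"
    by (auto elim!: Ints_cases simp: complex_eq_iff cos_int_2pin sin_int_2pin)
qed

definition char :: "int \<Rightarrow> circle \<Rightarrow> complex"
  where "char m x = cis (2 * pi * (of_int m * coord x))"

lemma char_to_circle: "char m (to_circle t) = cis (2 * pi * (of_int m * t))"
proof -
  have "of_int m * t = of_int m * frac t + of_int (m * \<lfloor>t\<rfloor>)"
    by (simp add: frac_def algebra_simps)
  then have "cis (2 * pi * (of_int m * t)) = cis (2 * pi * (of_int m * frac t)) * cis (2 * pi * of_int (m * \<lfloor>t\<rfloor>))"
    by (simp only: cis_mult ring_distribs)
  also have "cis (2 * pi * of_int (m * \<lfloor>t\<rfloor>)) = 1"
    by (subst cis_2pi_eq_1_iff) (rule Ints_of_int)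
  finally show ?thesis by (simp add: char_def coord_to_circle)
qed

lemma char_translate: "char m x = cis (2 * pi * (of_int m * t)) * char m (x - to_circle t)"
proof -
  have "char m (x - to_circle t) = cis (2 * pi * (of_int m * (coord x - t)))"
    using to_circle_diff[of "coord x" t] char_to_circle[of m "coord x - t"] by simp
  then show ?thesis by (simp add: char_def cis_mult algebra_simps)
qed

lemma char_add: "char (k + m) x = char k x * char m x"
  by (simp add: char_def cis_mult algebra_simps)

lemma char_0 [simp]: "char 0 x = 1"
  by (simp add: char_def)

lemma norm_char [simp]: "norm (char m x) = 1"
  by (simp add: char_def)

lemma borel_measurable_cis [measurable]: "cis \<in> borel_measurable borel"
  by (intro borel_measurable_continuous_onI continuous_intros)

lemma borel_measurable_char [measurable]: "char m \<in> borel_measurable borel"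
  unfolding char_def by measurable

lemma ess_bounded_char: "ess_bounded (char m)"
  by (auto simp: ess_bounded_def intro!: exI[of _ 1])

lemma char_uminus: "char (- m) x = cnj (char m x)"
  by (simp add: char_def cis_cnj)

text \<open>Compactness is borrowed from the real line: \<open>K\<close> is lifted to the closed
  interval \<open>{0..1}\<close>, where the doubled endpoint does no harm because
  \<open>char 1\<close> takes the same value at both ends.\<close>

lemma compact_char_image:
  assumes "closed K"
  shows "compact (char 1 ` K)"
proof -
  have "closed (to_circle -` K)"
    using assms by (simp add: closed_def open_circle_def vimage_Compl)
  then have "compact (to_circle -` K \<inter> {0..1})" by (intro closed_Int_compact) auto
  then have "compact ((\<lambda>t. cis (2 * pi * t)) ` (to_circle -` K \<inter> {0..1}))"
    by (intro compact_continuous_image continuous_intros)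
  also have "(\<lambda>t. cis (2 * pi * t)) ` (to_circle -` K \<inter> {0..1}) = char 1 ` K"
  proof (intro equalityI subsetI)
    fix z assume "z \<in> (\<lambda>t. cis (2 * pi * t)) ` (to_circle -` K \<inter> {0..1})"
    then obtain t where "z = cis (2 * pi * t)" "to_circle t \<in> K" by auto
    then show "z \<in> char 1 ` K"
      using char_to_circle[of 1 t] by (intro image_eqI[of _ _ "to_circle t"]) auto
  next
    fix z assume "z \<in> char 1 ` K"
    then obtain x where "z = char 1 x" "x \<in> K" by auto
    then show "z \<in> (\<lambda>t. cis (2 * pi * t)) ` (to_circle -` K \<inter> {0..1})"
      using coord_bounds[of x] by (intro image_eqI[of _ _ "coord x"]) (auto simp: char_def)
  qed
  finally show ?thesis .
qed

lemma inj_char: "inj (char 1)"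
proof (rule injI)
  fix x y assume "char 1 x = char 1 y"
  then have "cis (2 * pi * (coord x - coord y)) = 1"
    by (simp add: char_def right_diff_distrib flip: cis_divide)
  then have "coord x - coord y \<in> \<int>" by (simp add: cis_2pi_eq_1_iff)
  then have "to_circle (coord x) = to_circle (coord y)" by (simp only: to_circle_eq_iff)
  then show "x = y" by simp
qed

lemma ess_bounded_integrable: "ess_bounded f \<Longrightarrow> integrable circle_measure f"
  by (auto simp: ess_bounded_def intro: circle_measure.integrable_const_bound)

subsection \<open>Uniqueness of Fourier coefficients\<close>

text \<open>\<open>char m\<close> stands without conjugation since \<open>m\<close> runs through all
  integers anyway. Boundedness is built in so that every integral exists and products with
  characters stay in the class.\<close>

definition fourier_null :: "(circle \<Rightarrow> complex) \<Rightarrow> bool"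
  where "fourier_null f \<longleftrightarrow> ess_bounded f \<and> (\<forall>m. (\<integral>x. f x * char m x \<partial>circle_measure) = 0)"

lemma fourier_null_ess_bounded: "fourier_null f \<Longrightarrow> ess_bounded f"
  by (simp add: fourier_null_def)

lemma fourier_null_add:
  assumes "fourier_null f" "fourier_null g"
  shows "fourier_null (\<lambda>x. f x + g x)"
proof -
  have "integrable circle_measure (\<lambda>x. h x * char m x)" if "fourier_null h" for h m
    using that by (intro ess_bounded_integrable ess_bounded_mult ess_bounded_char fourier_null_ess_bounded)
  with assms show ?thesis
    by (simp add: fourier_null_def ess_bounded_add ring_distribs)
qed

lemma fourier_null_scale: "fourier_null f \<Longrightarrow> fourier_null (\<lambda>x. c * f x)"
  by (simp add: fourier_null_def ess_bounded_mult mult.assoc)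

lemma fourier_null_char:
  assumes "fourier_null f"
  shows "fourier_null (\<lambda>x. f x * char k x)"
  using assms unfolding fourier_null_def
  by (simp add: mult.assoc ess_bounded_mult ess_bounded_char flip: char_add)

text \<open>Multiplying by \<open>char 1\<close> or \<open>char (- 1)\<close> only shifts the
  Fourier coefficients, and a real-linear function of \<open>z\<close> is a combination of
  \<open>z\<close> and \<open>cnj z\<close>. Generalising over \<open>f\<close> lets products be
  handled one factor after the other.\<close>

lemma fourier_null_polynomial:
  assumes "real_polynomial_function p"
  shows "fourier_null f \<Longrightarrow> fourier_null (\<lambda>x. f x * of_real (p (char 1 x)))"
  using assms
proof (induction p arbitrary: f rule: real_polynomial_function.induct)
  case (linear p)
  \<comment> \<open>Obtained from p z = Re z * p 1 + Im z * p \<i> by writing Re z and Im z in terms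
    of z and its conjugate.\<close>
  define \<alpha> \<beta> where "\<alpha> = (of_real (p 1) - \<i> * of_real (p \<i>)) / 2" and "\<beta> = (of_real (p 1) + \<i> * of_real (p \<i>)) / 2"
  have p: "of_real (p z) = \<alpha> * z + \<beta> * cnj z" for z
  proof -
    interpret bounded_linear p by fact
    have "z = Re z *\<^sub>R 1 + Im z *\<^sub>R \<i>" by (simp add: complex_eq_iff)
    then have "p z = Re z * p 1 + Im z * p \<i>"
      by (metis add scaleR real_scaleR_def)
    then show ?thesis by (simp add: \<alpha>_def \<beta>_def complex_eq_iff field_simps)
  qed
  have "fourier_null (\<lambda>x. \<alpha> * (f x * char 1 x) + \<beta> * (f x * char (- 1) x))"
    using linear by (intro fourier_null_add fourier_null_scale fourier_null_char)
  then show ?case by (simp add: p char_uminus algebra_simps)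
next
  case (const c)
  then show ?case using fourier_null_scale[of f "of_real c"] by (simp add: mult.commute)
next
  case (add p q)
  have "fourier_null (\<lambda>x. f x * of_real (p (char 1 x)) + f x * of_real (q (char 1 x)))"
    using add by (intro fourier_null_add)
  then show ?case by (simp add: ring_distribs)
next
  case (mult p q)
  have "fourier_null (\<lambda>x. (f x * of_real (p (char 1 x))) * of_real (q (char 1 x)))"
    using mult by blast
  then show ?case by (simp add: mult.assoc)
qed

text \<open>Stone-Weierstrass on the unit circle replaces \<phi> by a polynomial within \<epsilon>;
  the polynomial integrates to 0, and the error is at most \<epsilon> times the bound of
  \<open>f\<close> times the total mass.\<close>

lemma fourier_null_continuous:
  fixes \<phi> :: "complex \<Rightarrow> real"
  assumes f: "fourier_null f" and \<phi>: "continuous_on UNIV \<phi>"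
  shows "(\<integral>x. f x * of_real (\<phi> (char 1 x)) \<partial>circle_measure) = 0"
proof -
  have [measurable]: "f \<in> borel_measurable circle_measure"
    using f by (auto simp: fourier_null_def ess_bounded_def)
  have [measurable]: "\<phi> \<in> borel_measurable borel"
    using \<phi> by (rule borel_measurable_continuous_onI)
  obtain B where B: "AE x in circle_measure. norm (f x) \<le> B"
    using f by (auto simp: fourier_null_def ess_bounded_def)
  define \<mu> where "\<mu> = measure circle_measure UNIV"
  have bound: "norm (\<integral>x. f x * of_real (\<phi> (char 1 x)) \<partial>circle_measure) \<le> \<epsilon> * (\<bar>B\<bar> * \<mu>)" if \<epsilon>: "0 < \<epsilon>" for \<epsilon>
  proof -
    obtain p where p: "polynomial_function p" "\<And>z. z \<in> sphere 0 1 \<Longrightarrow> norm (\<phi> z - p z) < \<epsilon>"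
      using Stone_Weierstrass_polynomial_function[of "sphere 0 1" \<phi> \<epsilon>] continuous_on_subset[OF \<phi>] \<epsilon>
      by (auto simp: compact_sphere)
    have rp: "real_polynomial_function p" using p(1) by (simp add: real_polynomial_function_eq)
    have [measurable]: "p \<in> borel_measurable borel"
      by (intro borel_measurable_continuous_onI continuous_on_polymonial_function p)
    have close: "\<bar>\<phi> (char 1 x) - p (char 1 x)\<bar> < \<epsilon>" for x
      using p(2)[of "char 1 x"] by simp
    have null: "fourier_null (\<lambda>x. f x * of_real (p (char 1 x)))"
      by (rule fourier_null_polynomial[OF rp f])
    then have zero: "(\<integral>x. f x * of_real (p (char 1 x)) \<partial>circle_measure) = 0"
      unfolding fourier_null_def using char_0 by (metis (mono_tags, lifting) Bochner_Integration.integral_cong mult.right_neutral)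
    have AE: "AE x in circle_measure. norm (f x * of_real (\<phi> (char 1 x) - p (char 1 x))) \<le> \<epsilon> * \<bar>B\<bar>"
      using B
    proof eventually_elim
      case (elim x)
      then have "norm (f x) * \<bar>\<phi> (char 1 x) - p (char 1 x)\<bar> \<le> \<bar>B\<bar> * \<epsilon>"
        using close[of x] by (intro mult_mono) auto
      then show ?case by (simp add: norm_mult mult.commute del: of_real_diff)
    qed
    have int: "integrable circle_measure (\<lambda>x. f x * of_real (\<phi> (char 1 x) - p (char 1 x)))"
      by (rule circle_measure.integrable_const_bound[OF AE]) measurable
    have "(\<integral>x. f x * of_real (\<phi> (char 1 x)) \<partial>circle_measure) =
        (\<integral>x. f x * of_real (\<phi> (char 1 x) - p (char 1 x)) + f x * of_real (p (char 1 x)) \<partial>circle_measure)"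
      by (simp add: algebra_simps)
    also have "\<dots> = (\<integral>x. f x * of_real (\<phi> (char 1 x) - p (char 1 x)) \<partial>circle_measure)"
      using int null by (subst Bochner_Integration.integral_add)
        (auto simp del: of_real_diff simp: zero intro: ess_bounded_integrable fourier_null_ess_bounded)
    also have "norm \<dots> \<le> (\<integral>x. \<epsilon> * \<bar>B\<bar> \<partial>circle_measure)"
      using int AE by (intro order_trans[OF integral_norm_bound] integral_mono_AE integrable_norm) simp_all
    also have "\<dots> = \<epsilon> * (\<bar>B\<bar> * \<mu>)" by (simp add: \<mu>_def)
    finally show ?thesis .
  qed
  have "norm (\<integral>x. f x * of_real (\<phi> (char 1 x)) \<partial>circle_measure) \<le> 0 + \<delta>" if "0 < \<delta>" for \<delta>
  proof -
    have K: "0 \<le> \<bar>B\<bar> * \<mu>" by (simp add: \<mu>_def)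
    \<comment> \<open>The summand 1 keeps the denominator positive even if the bound is 0.\<close>
    then have "\<delta> / (\<bar>B\<bar> * \<mu> + 1) * (\<bar>B\<bar> * \<mu>) \<le> \<delta>"
      using that by (simp add: field_simps)
    with bound[of "\<delta> / (\<bar>B\<bar> * \<mu> + 1)"] K that show ?thesis by simp
  qed
  then have "norm (\<integral>x. f x * of_real (\<phi> (char 1 x)) \<partial>circle_measure) \<le> 0"
    by (rule field_le_epsilon)
  then show ?thesis by simp
qed

text \<open>The indicator of \<open>K\<close> is the pointwise limit of continuous functions of
  \<open>char 1 x\<close> that fall off linearly, with slope growing to infinity, away from the
  image \<open>L\<close> of \<open>K\<close>; dominated convergence applies. Injectivity of
  \<open>char 1\<close> and closedness of \<open>L\<close> give points outside \<open>K\<close> a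
  positive distance.\<close>

lemma fourier_null_closed:
  assumes f: "fourier_null f" and K: "closed K"
  shows "(\<integral>x. indicator K x *\<^sub>R f x \<partial>circle_measure) = 0"
\<comment> \<open>The distance to the empty set is 0 by convention, so the approximating functions
  would be constantly 1.\<close>
proof (cases "K = {}")
  case False
  have [measurable]: "f \<in> borel_measurable circle_measure"
    using f by (auto simp: fourier_null_def ess_bounded_def)
  have [measurable]: "K \<in> sets borel" using K by (rule borel_closed)
  obtain B where B: "AE x in circle_measure. norm (f x) \<le> B"
    using f by (auto simp: fourier_null_def ess_bounded_def)
  define L where "L = char 1 ` K"
  have L: "closed L" "L \<noteq> {}"
    using compact_char_image[OF K] False by (auto simp: L_def intro: compact_imp_closed)
  define \<phi> where "\<phi> k z = max 0 (1 - real k * infdist z L)" for k z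
  have \<phi>: "continuous_on UNIV (\<phi> k)" for k
    unfolding \<phi>_def by (intro continuous_intros)
  then have [measurable]: "\<phi> k \<in> borel_measurable borel" for k
    by (rule borel_measurable_continuous_onI)
  have \<phi>_bound: "0 \<le> \<phi> k z" "\<phi> k z \<le> 1" for k z
    by (auto simp: \<phi>_def infdist_nonneg)
  have lim: "(\<lambda>k. \<phi> k (char 1 x)) \<longlonglongrightarrow> indicator K x" for x
  proof (cases "x \<in> K")
    case True
    then have "infdist (char 1 x) L = 0" by (simp add: L_def)
    with True show ?thesis by (simp add: \<phi>_def)
  next
    case False
    then have "char 1 x \<notin> L" using inj_char by (auto simp: L_def dest: injD)
    then have d: "0 < infdist (char 1 x) L"
      using L in_closed_iff_infdist_zero[of L "char 1 x"] infdist_nonneg[of "char 1 x" L] by force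
    then obtain N where N: "1 < real N * infdist (char 1 x) L"
      using reals_Archimedean3 by blast
    have "\<phi> k (char 1 x) = 0" if "N \<le> k" for k
    proof -
      have "real N * infdist (char 1 x) L \<le> real k * infdist (char 1 x) L"
        using d that by (intro mult_right_mono) auto
      with N show ?thesis by (simp add: \<phi>_def)
    qed
    then have "eventually (\<lambda>k. \<phi> k (char 1 x) = 0) sequentially"
      by (auto simp: eventually_sequentially)
    with False show ?thesis by (simp add: tendsto_eventually)
  qed
  have "(\<lambda>k. \<integral>x. f x * of_real (\<phi> k (char 1 x)) \<partial>circle_measure) \<longlonglongrightarrow>
      (\<integral>x. f x * of_real (indicator K x) \<partial>circle_measure)"
  proof (rule integral_dominated_convergence[where w = "\<lambda>_. B"])
    show "AE x in circle_measure. (\<lambda>k. f x * of_real (\<phi> k (char 1 x))) \<longlonglongrightarrow> f x * of_real (indicator K x)"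
      using lim by (intro AE_I2 tendsto_mult tendsto_const tendsto_of_real)
    show "AE x in circle_measure. norm (f x * of_real (\<phi> k (char 1 x))) \<le> B" for k
      using B
    proof eventually_elim
      case (elim x)
      have "norm (f x) * \<phi> k (char 1 x) \<le> norm (f x) * 1"
        by (intro mult_left_mono \<phi>_bound) auto
      with elim show ?case using \<phi>_bound(1)[of k "char 1 x"] by (simp add: norm_mult)
    qed
  qed auto
  then have "(\<integral>x. f x * of_real (indicator K x) \<partial>circle_measure) = 0"
    using fourier_null_continuous[OF f \<phi>] by (simp add: LIMSEQ_const_iff)
  then show ?thesis by (simp add: scaleR_conv_of_real mult.commute)
qed simp

text \<open>Closed sets form an intersection-stable generator of the Borel sets, so the vanishing of
  integrals over closed sets extends to all Borel sets, and a density all of whose integrals vanish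
  is 0 almost everywhere.\<close>

theorem fourier_uniqueness:
  assumes f: "fourier_null f"
  shows "AE x in circle_measure. f x = 0"
proof (rule circle_measure.density_zero)
  show int: "integrable circle_measure f"
    using f by (intro ess_bounded_integrable fourier_null_ess_bounded)
  fix A assume "A \<in> sets circle_measure"
  then have "Int_stable (Collect closed)" "Collect closed \<subseteq> Pow UNIV" "A \<in> sigma_sets UNIV (Collect closed)"
    by (auto simp: Int_stable_def borel_eq_closed)
  then show "set_lebesgue_integral circle_measure A f = 0"
    unfolding set_lebesgue_integral_def
  proof (induction A rule: sigma_sets_induct_disjoint)
    case (basic A)
    then show ?case using fourier_null_closed[OF f] by simp
  next
    case (compl A)
    have [measurable]: "A \<in> sets borel" using compl by (simp add: borel_eq_closed)
    have "indicator (UNIV - A) x *\<^sub>R f x = indicator UNIV x *\<^sub>R f x - indicator A x *\<^sub>R f x" for x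
      by (auto simp: indicator_def)
    moreover have "(\<integral>x. indicator UNIV x *\<^sub>R f x \<partial>circle_measure) = 0"
      by (rule fourier_null_closed[OF f]) simp
    ultimately show ?case
      using compl int by (simp add: integrable_mult_indicator)
  next
    case (union A)
    have [measurable]: "A i \<in> sets borel" for i using union by (auto simp: borel_eq_closed)
    have "set_lebesgue_integral circle_measure (\<Union>i. A i) f = (\<Sum>i. set_lebesgue_integral circle_measure (A i) f)"
      using union(1) int
      by (intro lebesgue_integral_countable_add)
        (auto simp: disjoint_family_on_def set_integrable_def intro!: integrable_mult_indicator)
    then show ?case using union by (simp add: set_lebesgue_integral_def)
  qed auto
qed

subsection \<open>Eigenfunctions and cocycles of an irrational rotation\<close>

text \<open>Translating the integral against \<open>char m\<close> multiplies it by \<mu> e^{2 \<pi>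
  i m \<theta>}, so it vanishes unless this factor is 1. The last assumption takes care of exactly
  these resonant frequencies.\<close>

lemma rotation_eigenfunction_null:
  assumes g: "ess_bounded g"
    and eq: "AE x in circle_measure. g x = \<mu> * g (x - to_circle \<theta>)"
    and "\<And>m. \<mu> * cis (2 * pi * (of_int m * \<theta>)) = 1 \<Longrightarrow> (\<integral>x. g x * char m x \<partial>circle_measure) = 0"
  shows "AE x in circle_measure. g x = 0"
proof (rule fourier_uniqueness)
  have gm [measurable]: "g \<in> borel_measurable borel"
    using g by (simp add: ess_bounded_def cong: measurable_cong_sets)
  have "(\<integral>x. g x * char m x \<partial>circle_measure) = 0" for m
  proof -
    let ?c = "\<mu> * cis (2 * pi * (of_int m * \<theta>))"
    have "(\<integral>x. g x * char m x \<partial>circle_measure) =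
        (\<integral>x. ?c * (g (x - to_circle \<theta>) * char m (x - to_circle \<theta>)) \<partial>circle_measure)"
    proof (rule integral_cong_AE)
      show "AE x in circle_measure. g x * char m x = ?c * (g (x - to_circle \<theta>) * char m (x - to_circle \<theta>))"
        using eq
      proof eventually_elim
        case (elim x)
        then show ?case using char_translate[of m x \<theta>] by (metis mult.assoc mult.left_commute)
      qed
    qed measurable
    also have "\<dots> = ?c * (\<integral>x. g x * char m x \<partial>distr circle_measure borel (\<lambda>x. x - to_circle \<theta>))"
      by (subst integral_distr) auto
    also have "\<dots> = ?c * (\<integral>x. g x * char m x \<partial>circle_measure)"
      by (simp add: distr_circle_translate)
    finally have "(1 - ?c) * (\<integral>x. g x * char m x \<partial>circle_measure) = 0"
      by (simp add: left_diff_distrib)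
    with assms(3)[of m] show ?thesis by auto
  qed
  with g show "fourier_null g" by (simp add: fourier_null_def)
qed

lemma irrational_mult_eq_0:
  assumes "\<theta> \<notin> \<rat>" "of_int k * \<theta> = of_int l"
  shows "k = 0"
proof (rule ccontr)
  assume "k \<noteq> 0"
  with assms(2) have "\<theta> = of_int l / of_int k" by (simp add: field_simps)
  with assms(1) show False by simp
qed

text \<open>For eigenvalue 1 and irrational \<theta> the only resonant frequency is 0. Subtracting
  the mean kills that coefficient because the total mass is 1.\<close>

lemma rotation_invariant_const:
  assumes f: "ess_bounded f" and \<theta>: "\<theta> \<notin> \<rat>"
    and eq: "AE x in circle_measure. f x = f (x - to_circle \<theta>)"
  shows "\<exists>c. AE x in circle_measure. f x = c"
proof -
  define c where "c = (\<integral>x. f x \<partial>circle_measure)"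
  have m1: "measure circle_measure UNIV = 1"
    by (simp add: measure_def emeasure_circle_measure)
  have "AE x in circle_measure. f x + - c = 0"
  proof (rule rotation_eigenfunction_null[where \<mu> = 1 and \<theta> = \<theta>])
    show "ess_bounded (\<lambda>x. f x + - c)" using f by (intro ess_bounded_add ess_bounded_const)
    show "AE x in circle_measure. f x + - c = 1 * (f (x - to_circle \<theta>) + - c)"
      using eq by eventually_elim simp
    fix m :: int assume "1 * cis (2 * pi * (of_int m * \<theta>)) = 1"
    then obtain l where "of_int m * \<theta> = of_int l" by (auto simp: cis_2pi_eq_1_iff elim: Ints_cases)
    then have "m = 0" using irrational_mult_eq_0[OF \<theta>] by blast
    then show "(\<integral>x. (f x + - c) * char m x \<partial>circle_measure) = 0"
      using f by (simp add: ess_bounded_integrable c_def m1)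
  qed
  then show ?thesis by (intro exI[of _ c]) simp
qed

lemma root_unity_eq_cis: "root_unity n ^ k = cis (2 * pi * (k / n))"
proof -
  have "root_unity n = cis (2 * pi / n)"
    by (simp add: root_unity_def cis_conv_exp mult.commute)
  then show ?thesis by (simp only: Complex.DeMoivre times_divide_eq_right mult_ac)
qed

lemma rotation_cocycle_null:
  assumes f: "ess_bounded f" and \<theta>: "0 < \<theta>" "\<theta> < 1" "\<theta> \<notin> \<rat>"
    and bc: "b < n" "c < n" "b \<noteq> 0 \<or> c \<noteq> 0"
    and eq: "AE x in circle_measure. f x = root_unity n ^ (if coord x < \<theta> then b else c) * f (x - to_circle \<theta>)"
  shows "AE x in circle_measure. f x = 0"
proof -
  have n: "n > 0" using bc by simp
  \<comment> \<open>Taken in the reals, as the difference may be negative.\<close>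
  define s where "s = real b - real c"
  define h where "h x = cis (2 * pi * (s * coord x / n))" for x
  have [measurable]: "h \<in> borel_measurable borel" unfolding h_def by measurable
  have "ess_bounded h" by (auto simp: ess_bounded_def h_def intro!: exI[of _ 1])
  \<comment> \<open>On the arc the wrap-around of \<open>coord\<close> adds \<open>s / n\<close> to
    the phase on the right, which is exactly \<open>b / n - c / n\<close>.\<close>
  have cocycle: "root_unity n ^ (if coord x < \<theta> then b else c) * h x =
      cis (2 * pi * ((c + s * \<theta>) / n)) * h (x - to_circle \<theta>)" for x
  proof -
    have "(if coord x < \<theta> then b else c) / n + s * coord x / n =
        (c + s * \<theta>) / n + s * coord (x - to_circle \<theta>) / n"
      using \<theta> n by (simp add: coord_translate s_def field_simps)
    then show ?thesis
      unfolding root_unity_eq_cis h_def by (simp only: cis_mult ring_distribs(1)[symmetric])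
  qed
  have "AE x in circle_measure. f x * h x = 0"
  proof (rule rotation_eigenfunction_null[where \<mu> = "cis (2 * pi * ((c + s * \<theta>) / n))" and \<theta> = \<theta>])
    show "ess_bounded (\<lambda>x. f x * h x)" by (intro ess_bounded_mult f) fact
    show "AE x in circle_measure. f x * h x =
        cis (2 * pi * ((c + s * \<theta>) / n)) * (f (x - to_circle \<theta>) * h (x - to_circle \<theta>))"
      using eq
    proof eventually_elim
      case (elim x)
      then show ?case using cocycle[of x] by (metis mult.assoc mult.commute)
    qed
    fix m :: int
    assume "cis (2 * pi * ((c + s * \<theta>) / n)) * cis (2 * pi * (of_int m * \<theta>)) = 1"
    then have "cis (2 * pi * ((c + s * \<theta>) / n + of_int m * \<theta>)) = 1"
      by (simp add: cis_mult ring_distribs)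
    then obtain l :: int where l: "(c + s * \<theta>) / n + of_int m * \<theta> = of_int l"
      by (auto simp: cis_2pi_eq_1_iff elim: Ints_cases)
    \<comment> \<open>Clearing the denominator leaves integers on both sides of \<theta>, so
      irrationality makes each of them 0; then \<open>n\<close> divides \<open>c\<close>, and with
      it \<open>b\<close>.\<close>
    then have *: "of_int (int b - int c + int n * m) * \<theta> = of_int (int n * l - int c)"
      using n by (simp add: s_def field_simps)
    then have k: "int b - int c + int n * m = 0" by (rule irrational_mult_eq_0[OF \<theta>(3)])
    with * have "of_int (int n * l - int c) = (0 :: real)" by (metis mult_zero_left of_int_0)
    then have "int c = int n * l" by linarith
    then have "int n dvd int c" by simp
    then have "c = 0" using bc by (auto dest: zdvd_imp_le)
    moreover from this k have "int n dvd int b" by (metis add_diff_cancel_left' add_eq_0_iff diff_zero dvd_minus_iff dvd_triv_left minus_equation_iff of_nat_0)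
    then have "b = 0" using bc by (auto dest: zdvd_imp_le)
    \<comment> \<open>Resonance contradicts the assumption that \<open>b\<close> or \<open>c\<close>
      is nonzero, so no integral has to be computed.\<close>
    ultimately show "(\<integral>x. f x * h x * char m x \<partial>circle_measure) = 0" using bc by simp
  qed
  then show ?thesis
    by eventually_elim (simp add: h_def)
qed

subsection \<open>The fixed point algebra\<close>

lemma norm_root_unity [simp]: "norm (root_unity n) = 1"
  using root_unity_eq_cis[of n 1] by simp

lemma root_unity_power_cnj: "root_unity n ^ k * cnj (root_unity n ^ k) = 1"
  unfolding complex_norm_square[symmetric] by (simp add: norm_power)

lemma root_unity_power_mod: "n > 0 \<Longrightarrow> root_unity n ^ (c * (k mod n)) = root_unity n ^ (c * k)"
proof -
  assume n: "n > 0"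
  have "root_unity n ^ (c * k) = root_unity n ^ (n * (c * (k div n)) + c * (k mod n))"
    by (metis distrib_left mult.left_commute mult_div_mod_eq)
  then show ?thesis by (simp add: power_add power_mult root_unity_power[OF n])
qed

text \<open>For distinct indices this is a geometric sum whose ratio \<open>z\<close> is an
  \<open>n\<close>-th root of unity; \<open>z\<close> differs from 1 because the indices differ by
  less than \<open>n\<close>.\<close>

lemma root_unity_orthogonality:
  assumes "i < n" "k < n"
  shows "(\<Sum>c<n. cnj (root_unity n ^ (c * i)) * root_unity n ^ (c * k)) = (if i = k then of_nat n else 0)"
proof (cases "i = k")
  case True
  then have "cnj (root_unity n ^ (c * i)) * root_unity n ^ (c * k) = 1" for c
    using root_unity_power_cnj[of n "c * i"] by (simp add: mult.commute)
  with True show ?thesis by simp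
next
  case False
  define z where "z = cnj (root_unity n ^ i) * root_unity n ^ k"
  have z: "z = cis (2 * pi * ((real k - real i) / n))"
    unfolding z_def root_unity_eq_cis cis_cnj cis_mult by (simp add: diff_divide_distrib algebra_simps)
  have "(real k - real i) / n \<notin> \<int>"
  proof
    assume "(real k - real i) / n \<in> \<int>"
    then obtain l :: int where "(real k - real i) / n = of_int l" by (auto elim: Ints_cases)
    then have l: "real k - real i = of_int l * real n" using assms by (simp add: field_simps)
    then have "\<bar>of_int l * real n\<bar> < 1 * real n" using assms by linarith
    then have "\<bar>real_of_int l\<bar> < 1"
      unfolding abs_mult using assms by (simp add: mult_less_cancel_right del: mult_1)
    then have "l = 0" by linarith
    with l False show False by simp
  qed
  then have "z \<noteq> 1" unfolding z cis_2pi_eq_1_iff .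
  have r: "root_unity n ^ n = 1" using root_unity_power[of n] assms by simp
  then have "cnj (root_unity n) ^ n = 1" by (simp flip: complex_cnj_power)
  with r have "z ^ n = 1"
    by (simp add: z_def power_mult_distrib flip: power_mult)
      (simp add: mult.commute[of _ n] power_mult)
  with \<open>z \<noteq> 1\<close> have "(\<Sum>c<n. z ^ c) = 0" by (simp add: geometric_sum)
  moreover have "cnj (root_unity n ^ (c * i)) * root_unity n ^ (c * k) = z ^ c" for c
    by (simp add: z_def power_mult_distrib mult.commute[of c] flip: power_mult)
  ultimately show ?thesis using False by simp
qed

text \<open>The predecessor modulo \<open>n\<close>; adding \<open>n - 1\<close> avoids truncated
  subtraction at 0.\<close>

definition cyc_pred :: "nat \<Rightarrow> nat \<Rightarrow> nat"
  where "cyc_pred n i = (i + (n - 1)) mod n"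

lemma cyc_pred_less: "n > 0 \<Longrightarrow> cyc_pred n i < n"
  by (simp add: cyc_pred_def)

lemma cyc_pred_Suc:
  assumes "k < n"
  shows "cyc_pred n (Suc k mod n) = k"
proof -
  have "cyc_pred n (Suc k mod n) = (Suc k + (n - 1)) mod n"
    by (simp only: cyc_pred_def mod_add_left_eq)
  also have "Suc k + (n - 1) = k + n" using assms by simp
  finally show ?thesis using assms by simp
qed

lemma Suc_cyc_pred: "i < n \<Longrightarrow> Suc (cyc_pred n i) mod n = i"
  by (simp add: cyc_pred_def mod_simps)

lemma eq_Suc_mod_iff: "i < n \<Longrightarrow> j < n \<Longrightarrow> i = Suc j mod n \<longleftrightarrow> j = cyc_pred n i"
  using cyc_pred_Suc[of j n] Suc_cyc_pred[of i n] by auto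

lemma cyc_pred_add: "cyc_pred n ((i + b) mod n) = (cyc_pred n i + b) mod n"
  by (simp add: cyc_pred_def mod_simps ac_simps)

lemma bij_betw_Suc_mod: "n > 0 \<Longrightarrow> bij_betw (\<lambda>k. Suc k mod n) {..<n} {..<n}"
  by (rule bij_betwI[where g = "cyc_pred n"]) (auto simp: cyc_pred_less cyc_pred_Suc Suc_cyc_pred)

text \<open>The symbol of W. The shift has its 1 in row \<open>i\<close> at column
  \<open>i + 1\<close> modulo \<open>n\<close>, so its adjoint has it at the cyclic predecessor of
  \<open>i\<close>.\<close>

definition cocycle :: "nat \<Rightarrow> real \<Rightarrow> mat_fun"
  where "cocycle n \<theta> = (\<lambda>i j x. if coord x < \<theta> then (if j = i then cnj (root_unity n ^ i) else 0)
    else (if j = cyc_pred n i then 1 else 0))"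

lemma mat_bounded_cocycle: "mat_bounded n (cocycle n \<theta>)"
  unfolding mat_bounded_def ess_bounded_def
proof (intro allI impI conjI exI AE_I2)
  fix i j x
  show "cocycle n \<theta> i j \<in> borel_measurable circle_measure"
    unfolding cocycle_def by measurable
  show "norm (cocycle n \<theta> i j x) \<le> 1"
    by (simp add: cocycle_def norm_power)
qed

lemma op_add_clock_shift:
  assumes "n > 0" "\<theta> \<le> 1"
  shows "op_add n
      (op_tensor n (mult_op (indicator {x. coord x < \<theta>})) (mat_adjoint (clock_mat n)))
      (op_tensor n (mult_op (indicator (UNIV - {x. coord x < \<theta>}))) (mat_adjoint (shift_mat n))) =
    Mop n (cocycle n \<theta>)"
proof -
  have bd: "ess_bounded (indicator S)" if "S \<in> sets borel" for S
    using that by (auto simp: ess_bounded_def indicator_def intro!: exI[of _ 1])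
  have [measurable]: "{x. coord x < \<theta>} \<in> sets borel" by measurable
  have C: "ess_bounded (indicator {x. coord x < \<theta>})"
    and D: "ess_bounded (indicator (UNIV - {x. coord x < \<theta>}))"
    by (auto intro!: bd)
  have clock: "mat_adjoint (clock_mat n) $$ (i, j) = (if j = i then cnj (root_unity n ^ i) else 0)"
    if "i < n" "j < n" for i j
    using that by (auto simp: mat_adjoint_def clock_mat_def mat_of_rows_def)
  have shift: "mat_adjoint (shift_mat n) $$ (i, j) = (if j = cyc_pred n i then 1 else 0)"
    if "i < n" "j < n" for i j
    using that by (auto simp: mat_adjoint_def shift_mat_def mat_of_rows_def eq_Suc_mod_iff)
  have bdM: "mat_bounded n (\<lambda>i j x. a $$ (i, j) * f x)" if "ess_bounded f" for a :: "complex mat" and f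
    using that by (auto simp: mat_bounded_def intro!: ess_bounded_mult)
  show ?thesis
    unfolding op_tensor_mult_op[OF C] op_tensor_mult_op[OF D] op_add_Mop[OF bdM[OF C] bdM[OF D]]
    by (rule Mop_cong, rule ext) (simp add: clock shift cocycle_def)
qed

text \<open>Every row of the cocycle has a single nonzero entry, so the matrix product collapses to
  one term.\<close>

lemma mat_prod_cocycle_left:
  assumes "i < n"
  shows "mat_prod n (cocycle n \<theta>) G i j x =
    (if coord x < \<theta> then cnj (root_unity n ^ i) * G i j x else G (cyc_pred n i) j x)"
proof -
  have [simp]: "cyc_pred n i < n" using assms by (simp add: cyc_pred_less)
  have eq: "(if k = l then z else 0) * G k j x = (if k = l then z * G k j x else 0)" for k l z
    by simp
  show ?thesis using assms by (simp add: mat_prod_def cocycle_def eq)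
qed

lemma mat_prod_cocycle_adj_right:
  assumes "j < n"
  shows "mat_prod n G (mat_adj (cocycle n \<theta>)) i j x =
    (if coord x < \<theta> then G i j x * root_unity n ^ j else G i (cyc_pred n j) x)"
proof -
  have [simp]: "cyc_pred n j < n" using assms by (simp add: cyc_pred_less)
  have eq: "G i k x * cnj (if k = l then z else 0) = (if k = l then G i k x * cnj z else 0)" for k l z
    by simp
  show ?thesis using assms by (simp add: mat_prod_def mat_adj_def cocycle_def eq)
qed

lemma mat_adj_cocycle_prod:
  assumes "i < n" "j < n"
  shows "mat_prod n (mat_adj (cocycle n \<theta>)) (cocycle n \<theta>) i j x = (if i = j then 1 else 0)"
proof (cases "coord x < \<theta>")
  case True
  have "cnj (if i = k then cnj (root_unity n ^ k) else 0) * (if j = k then cnj (root_unity n ^ k) else 0) =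
      (if k = i then if i = j then 1 else 0 else 0)" for k
    using root_unity_power_cnj[of n k] by auto
  then show ?thesis
    using True assms by (simp add: mat_prod_def mat_adj_def cocycle_def)
next
  case False
  \<comment> \<open>Here the summation index runs over rows, and column \<open>i\<close> has its
    only nonzero entry in the row of the cyclic successor of \<open>i\<close>.\<close>
  have eq: "cnj (if i = cyc_pred n k then 1 else 0) * (if j = cyc_pred n k then 1 else 0) =
      (if k = Suc i mod n then if i = j then 1 else 0 else 0)" if "k < n" for k
    using assms that by (auto simp: cyc_pred_Suc Suc_cyc_pred)
  show ?thesis
    using False assms by (simp add: mat_prod_def mat_adj_def cocycle_def eq cong: sum.cong_simp)
qed

lemma unitary_mat_fun_cocycle: "unitary_mat_fun n (cocycle n \<theta>)"
proof
  show "mat_bounded n (cocycle n \<theta>)" by (rule mat_bounded_cocycle)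
  fix i j x assume ij: "i < n" "j < n"
  then show "mat_prod n (mat_adj (cocycle n \<theta>)) (cocycle n \<theta>) i j x = (if i = j then 1 else 0)"
    by (rule mat_adj_cocycle_prod)
  have "cyc_pred n i = cyc_pred n j \<longleftrightarrow> i = j"
    using ij by (metis Suc_cyc_pred)
  then show "mat_prod n (cocycle n \<theta>) (mat_adj (cocycle n \<theta>)) i j x = (if i = j then 1 else 0)"
    using ij root_unity_power_cnj[of n i]
    unfolding mat_prod_cocycle_left[OF ij(1)] mat_adj_def
    by (auto simp: cocycle_def mult.commute)
qed

section \<open>Components of a matrix function and ergodicity of the conjugation\<close>

locale clock_shift_rotation =
  fixes n :: nat and \<theta> :: real
  assumes n_pos: "n > 0" and \<theta>: "0 < \<theta>" "\<theta> < 1" "\<theta> \<notin> \<rat>"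
begin

sublocale unitary_mat_fun n "cocycle n \<theta>" "to_circle \<theta>"
  by (rule unitary_mat_fun_cocycle)

lemma mat_conj_cocycle:
  assumes "i < n" "j < n"
  shows "mat_conj F i j x =
    (if coord x < \<theta> then cnj (root_unity n ^ i) * (F i j (x - to_circle \<theta>) * root_unity n ^ j)
     else F (cyc_pred n i) (cyc_pred n j) (x - to_circle \<theta>))"
  using assms
  by (simp add: mat_conj_def mat_prod_cocycle_left mat_prod_cocycle_adj_right mat_shift_def)

text \<open>
  Up to normalisation, the component of $F$ along the eigenspace of $\mathrm{Ad}(u^*)$ and
  $\mathrm{Ad}(v^*)$ with eigenvalues $\omega^b$ and $\omega^c$.
\<close>

definition coeff :: "mat_fun \<Rightarrow> nat \<Rightarrow> nat \<Rightarrow> circle \<Rightarrow> complex"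
  where "coeff F c b x = (\<Sum>i<n. root_unity n ^ (c * i) * F i ((i + b) mod n) x)"

lemma ess_bounded_coeff:
  assumes "mat_bounded n F"
  shows "ess_bounded (coeff F c b)"
  unfolding coeff_def using assms n_pos
  by (intro ess_bounded_sum ess_bounded_mult ess_bounded_const) (simp add: mat_bounded_def)

text \<open>On the arc, conjugation scales the entry \<open>(i, i + b)\<close> by \<omega>^(-i)
  \<omega>^(i + b) = \<omega>^b. Off the arc it moves entries one step along the same cyclic
  diagonal, and reindexing the sum by the successor releases the factor \<omega>^c.\<close>

lemma coeff_conj:
  "coeff (mat_conj F) c b x =
    root_unity n ^ (if coord x < \<theta> then b else c) * coeff F c b (x - to_circle \<theta>)"
proof (cases "coord x < \<theta>")
  case True
  have *: "root_unity n ^ (c * i) * mat_conj F i ((i + b) mod n) x =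
      root_unity n ^ b * (root_unity n ^ (c * i) * F i ((i + b) mod n) (x - to_circle \<theta>))" if "i < n" for i
  proof -
    have "root_unity n ^ ((i + b) mod n) = root_unity n ^ i * root_unity n ^ b"
      using root_unity_power_mod[OF n_pos, of 1 "i + b"] by (simp add: power_add)
    then have "root_unity n ^ (c * i) * mat_conj F i ((i + b) mod n) x =
        (root_unity n ^ i * cnj (root_unity n ^ i)) *
        (root_unity n ^ b * (root_unity n ^ (c * i) * F i ((i + b) mod n) (x - to_circle \<theta>)))"
      using True that n_pos by (simp add: mat_conj_cocycle mult_ac)
    then show ?thesis by (simp only: root_unity_power_cnj mult_1_left)
  qed
  show ?thesis
    unfolding coeff_def sum_distrib_left by (intro sum.cong) (simp_all only: True if_True * lessThan_iff)
next
  case False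
  have "coeff (mat_conj F) c b x =
      (\<Sum>k<n. root_unity n ^ (c * (Suc k mod n)) * mat_conj F (Suc k mod n) ((Suc k mod n + b) mod n) x)"
    unfolding coeff_def by (rule sum.reindex_bij_betw[OF bij_betw_Suc_mod[OF n_pos], symmetric])
  also have "\<dots> = (\<Sum>k<n. root_unity n ^ c * (root_unity n ^ (c * k) * F k ((k + b) mod n) (x - to_circle \<theta>)))"
  proof (rule sum.cong)
    fix k assume "k \<in> {..<n}"
    then show "root_unity n ^ (c * (Suc k mod n)) * mat_conj F (Suc k mod n) ((Suc k mod n + b) mod n) x =
        root_unity n ^ c * (root_unity n ^ (c * k) * F k ((k + b) mod n) (x - to_circle \<theta>))"
      using False n_pos unfolding root_unity_power_mod[OF n_pos]
      by (simp add: mat_conj_cocycle cyc_pred_add cyc_pred_Suc power_add mult.assoc del: mod_add_left_eq)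
  qed simp
  finally show ?thesis using False by (simp add: coeff_def sum_distrib_left)
qed

text \<open>For fixed \<open>b\<close>, \<open>coeff\<close> is a discrete Fourier transform along
  the \<open>b\<close>-th cyclic diagonal, and orthogonality of the roots of unity inverts it. The
  components therefore determine every entry of \<open>F\<close>.\<close>

lemma coeff_inversion:
  assumes "i < n"
  shows "(\<Sum>c<n. cnj (root_unity n ^ (c * i)) * coeff F c b x) = of_nat n * F i ((i + b) mod n) x"
proof -
  have "(\<Sum>c<n. cnj (root_unity n ^ (c * i)) * coeff F c b x) =
      (\<Sum>c<n. \<Sum>k<n. (cnj (root_unity n ^ (c * i)) * root_unity n ^ (c * k)) * F k ((k + b) mod n) x)"
    by (simp add: coeff_def sum_distrib_left mult.assoc)
  also have "\<dots> = (\<Sum>k<n. (\<Sum>c<n. cnj (root_unity n ^ (c * i)) * root_unity n ^ (c * k)) * F k ((k + b) mod n) x)"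
    unfolding sum_distrib_right by (rule sum.swap)
  also have "\<dots> = (\<Sum>k<n. if k = i then of_nat n * F k ((k + b) mod n) x else 0)"
    using assms by (intro sum.cong) (auto simp only: root_unity_orthogonality lessThan_iff mult_zero_left split: if_splits)
  finally show ?thesis using assms by simp
qed

lemma fixed_point_scalar:
  assumes F: "mat_bounded n F" and fixed: "Ad n U (Mop n F) = Mop n F"
  shows "\<exists>c. Mop n F = op_scale n c (op_one n)"
proof -
  have "\<forall>i\<in>{..<n}. \<forall>j\<in>{..<n}. AE x in circle_measure. mat_conj F i j x = F i j x"
    using fixed F by (simp add: Ad_Mop Mop_eq_iff mat_bounded_mat_conj)
  \<comment> \<open>Finitely many entries, hence one null set outside which all entrywise equations
    hold together, as the sum in \<open>coeff\<close> requires.\<close>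
  then have "AE x in circle_measure. \<forall>i\<in>{..<n}. \<forall>j\<in>{..<n}. mat_conj F i j x = F i j x"
    by (intro AE_finite_allI ballI) auto
  then have eq: "AE x in circle_measure. coeff F c b x =
      root_unity n ^ (if coord x < \<theta> then b else c) * coeff F c b (x - to_circle \<theta>)" for c b
  proof eventually_elim
    case (elim x)
    then have "coeff F c b x = coeff (mat_conj F) c b x"
      using n_pos by (simp add: coeff_def)
    then show ?case by (simp add: coeff_conj)
  qed
  have "AE x in circle_measure. coeff F 0 0 x = coeff F 0 0 (x - to_circle \<theta>)"
    using eq[of 0 0] by simp
  \<comment> \<open>\<open>coeff F 0 0\<close> is the trace of \<open>F\<close>, so the scalar
    obtained at the end is the normalised trace \<kappa> / n.\<close>
  then obtain \<kappa> where \<kappa>: "AE x in circle_measure. coeff F 0 0 x = \<kappa>"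
    using rotation_invariant_const[OF ess_bounded_coeff[OF F] \<theta>(3)] by blast
  have "AE x in circle_measure. coeff F c b x = (if c = 0 \<and> b = 0 then \<kappa> else 0)"
    if "c < n" "b < n" for c b
  proof (cases "c = 0 \<and> b = 0")
    case False
    with rotation_cocycle_null[OF ess_bounded_coeff[OF F] \<theta> that(2,1) _ eq] show ?thesis by auto
  qed (use \<kappa> in auto)
  then have "AE x in circle_measure. \<forall>c\<in>{..<n}. \<forall>b\<in>{..<n}. coeff F c b x = (if c = 0 \<and> b = 0 then \<kappa> else 0)"
    by (intro AE_finite_allI ballI) auto
  then have "AE x in circle_measure. F i j x = (if i = j then \<kappa> / n else 0)" if ij: "i < n" "j < n" for i j
  proof eventually_elim
    case (elim x)
    \<comment> \<open>The cyclic diagonal through \<open>(i, j)\<close>; the form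
      \<open>j + (n - i)\<close> avoids a truncated difference.\<close>
    define b where "b = (j + (n - i)) mod n"
    have b: "b < n" "(i + b) mod n = j" "b = 0 \<longleftrightarrow> i = j"
    proof -
      show "b < n" using n_pos by (simp add: b_def)
      show 1: "(i + b) mod n = j" using ij by (simp add: b_def mod_simps)
      show "b = 0 \<longleftrightarrow> i = j" using ij 1 by (auto simp: b_def)
    qed
    have "of_nat n * F i j x = (\<Sum>c<n. cnj (root_unity n ^ (c * i)) * coeff F c b x)"
      using coeff_inversion[OF ij(1), of F b x] b by simp
    also have "\<dots> = (\<Sum>c<n. if c = 0 then if i = j then \<kappa> else 0 else 0)"
      using elim b by (intro sum.cong) auto
    also have "\<dots> = (if i = j then \<kappa> else 0)" using n_pos by simp
    finally show ?case using n_pos by (auto simp: field_simps split: if_splits)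
  qed
  moreover have "mat_bounded n (\<lambda>i j x. if i = j then \<kappa> / n else 0)"
    by (simp add: mat_bounded_def)
  ultimately have "Mop n F = Mop n (\<lambda>i j x. if i = j then \<kappa> / n else 0)"
    using F by (simp add: Mop_eq_iff)
  then show ?thesis by (auto simp: op_scale_one)
qed

text \<open>Scalars are fixed because \<open>U\<close> commutes with scaling and is inverse to
  \<open>U'\<close>; the other inclusion is \<open>fixed_point_scalar\<close>.\<close>

lemma acts_ergodically_Linf: "acts_ergodically n (Linf_tensor_M n) (Ad n U)"
  unfolding acts_ergodically_def
proof (intro equalityI subsetI)
  fix T assume "T \<in> {T \<in> Linf_tensor_M n. Ad n U T = T}"
  then show "T \<in> range (\<lambda>c. op_scale n c (op_one n))"
    using fixed_point_scalar by (auto simp: Linf_tensor_M_eq)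
next
  fix T assume "T \<in> range (\<lambda>c. op_scale n c (op_one n))"
  then obtain c where T: "T = op_scale n c (op_one n)" by auto
  have "mat_bounded n (\<lambda>i j x. if i = j then c else 0)"
    by (simp add: mat_bounded_def)
  then have "T \<in> Linf_tensor_M n"
    by (auto simp: T op_scale_one Linf_tensor_M_eq)
  moreover have "Ad n U T = T"
    unfolding T
    by (intro opers_eqI[of _ n] Ad_in_opers op_scale_in_opers op_one_in_opers)
      (simp add: Ad_apply op_scale_def op_one_def in_tensor U_scale U_U')
  ultimately show "T \<in> {T \<in> Linf_tensor_M n. Ad n U T = T}" by simp
qed

end

theorem proposition4p11:
  fixes \<theta> :: real and n :: nat and C D :: "circle set" and V W :: oper
  assumes "0 < \<theta>" "\<theta> < 1 / 2" "\<theta> \<notin> \<rat>" and "n > 1"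
    and "C = to_circle ` {0..<\<theta>}" and "D = UNIV - C"
    and "V = op_tensor n (l2_translate (to_circle \<theta>)) (1\<^sub>m n)"
    and "W = op_add n
      (op_tensor n (mult_op (indicator C)) (mat_adjoint (clock_mat n)))
      (op_tensor n (mult_op (indicator D)) (mat_adjoint (shift_mat n)))"
  shows "star_automorphism n (Linf_tensor_M n) (Ad n (op_mult n W V)) \<and>
    acts_ergodically n (Linf_tensor_M n) (Ad n (op_mult n W V))"
proof -
  interpret clock_shift_rotation n \<theta>
    using assms(1-4) by unfold_locales auto
  \<comment> \<open>The arc becomes a condition on the fractional part, the form in which the
    cocycle is expressed.\<close>
  have "C = {x. coord x < \<theta>}"
    unfolding assms(5) using assms(2) by (intro to_circle_image_Ico) simp
  then have "W = Mop n (cocycle n \<theta>)"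
    using assms(2,4) by (simp add: assms(6,8) op_add_clock_shift)
  then have "op_mult n W V = U"
    by (simp add: U_def assms(7) op_tensor_l2_translate)
  then show ?thesis
    using star_automorphism_Linf acts_ergodically_Linf by simp
qed

end
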